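(* Suppose that the level set $\mathcal{X}=\{x\in\mathbb{R}^n:F(x)\le F(x^{(0)})\}$ is compact. Let $(x^{\star},y^{\star})\in\mathbb{R}^n\times\mathbb{R}^n$ be an accumulation point of the sequence $\{(x^{(t)},y^{(t)}):t\in\mathbb{N}\}$ generated by CMPGA. Then: (i) $(x^{\star},y^{\star})\in\mathcal{S}$ and $\inf\{\eta(x^{(t)},y^{(t)}):t\in\mathbb{N}\}>0$; (ii) $x^{\star}\in\mathrm{dom}(F)$ is a critical point of $F$ with $F(x^{\star})y^{\star}\in F(x^{\star})\,\partial g(x^{\star})$.
   Context: Setting. $f,g,h:\mathbb{R}^n\to(-\infty,+\infty]$ are proper lower semicontinuous functions, $\Omega:=\{x\in\mathbb{R}^n: g(x)\neq 0\}$ is nonempty, and $f$ is block-separable: $f(x)=\sum_{i=1}^N f_i(x_i)$, where the subvectors $x_i\in\mathbb{R}^{n_i}$ form a partition of the components of $x$ and each $f_i:\mathbb{R}^{n_i}\to(-\infty,+\infty]$ is proper lower semicontinuous. Standing assumptions: (a) $f$ is continuous on $\mathrm{dom}(f)$ and each $f_i$ is bounded below; (b) $h$ is locally Lipschitz differentiable on $\Omega$, i.e. every $x\in\Omega$ has a neighborhood $\mathcal{B}(x)$ and a constant $L_x$ with $\|\nabla h(u)-\nabla h(v)\|_2\le L_x\|u-v\|_2$ for all $u,v\in\mathcal{B}(x)\cap\Omega$; (c) $g$ is convex, real-valued and nonnegative on $\mathbb{R}^n$; (d) $f+h\ge 0$ on $\mathrm{dom}(f)$. Notation. $\mathrm{dom}(\varphi)=\{x:\varphi(x)<+\infty\}$;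 $g^*(y)=\sup_x\{\langle x,y\rangle-g(x)\}$; $\partial g$ is the convex subdifferential; $\nabla_ih$ is the partial gradient with respect to $x_i$; $\zeta(x):=f(x)+h(x)$; $\eta(x,y):=\langle x,y\rangle-g^*(y)$. $F(x)=\zeta(x)/g(x)$ if $x\in\Omega\cap\mathrm{dom}(f)$ and $F(x)=+\infty$ otherwise. $Q(x,y)=\zeta(x)/\eta(x,y)$ if $(x,y)\in\mathrm{dom}(f)\times\mathrm{dom}(g^* )$ and $\eta(x,y)>0$, and $Q(x,y)=+\infty$ otherwise. $\mathrm{prox}_{\varphi}(x)=\arg\min_z\{\varphi(z)+\frac12\|z-x\|_2^2\}$ (possibly set-valued). $[s]_+=\max\{0,s\}$. The Fréchet subdifferential of a proper $\varphi$ at $x\in\mathrm{dom}(\varphi)$ is $\widehat{\partial}\varphi(x)=\{y:\liminf_{z\to x,z\ne x}\frac{\varphi(z)-\varphi(x)-\langle y,z-x\rangle}{\|z-x\|_2}\ge0\}$. $x^{\star}\in\mathrm{dom}(F)$ is a critical point of $F$ if $0\in\widehat{\partial}f(x^{\star})+\nabla h(x^{\star})-F(x^{\star})\,\partial g(x^{\star})$. Algorithm MPGA. Input: $x^{(0)}\in\mathrm{dom}(F)$, $y^{(0)}\in\partial g(x^{(0)})$, reals $0<\underline{\alpha}\le\overline{\alpha}$, $\sigma>0$, $0<\gamma<1$, an integer $M\ge0$. For $t=0,1,2,\dots$: Step 1. Let $Q_{(t)}=Q(x^{(t)},y^{(t)})$ and $l(t)=\max\{j\le t:Q_{(j)}=\max\{Q_{(s)}:[t-M]_+\le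 s\le t\}\}$. Step 2. Pick $i\in\{0,1,\dots,N\}$ and an initial $\alpha\in[\underline{\alpha},\overline{\alpha}]$. Step 2-Y (if $i=0$): set $x^{(t+1)}=x^{(t)}$, $y^{(t+1)}=\mathrm{prox}_{\alpha g^*}(y^{(t)}+\alpha x^{(t)})$. Step 2-X (if $i\ge1$): compute $x_i^{(t)}(\alpha)\in\mathrm{prox}_{\alpha f_i}\big(x_i^{(t)}-\alpha\nabla_ih(x^{(t)})+\alpha Q_{(t)}y_i^{(t)}\big)$ and let $x^{(t),i}(\alpha)$ be $x^{(t)}$ with its $i$-th block replaced by $x_i^{(t)}(\alpha)$. If $\zeta(x^{(t),i}(\alpha))+\frac{\sigma}{2}\|x^{(t),i}(\alpha)-x^{(t)}\|_2^2\le Q_{(l(t))}\,\eta(x^{(t),i}(\alpha),y^{(t)})$, set $(x^{(t+1)},y^{(t+1)})=(x^{(t),i}(\alpha),y^{(t)})$; otherwise replace $\alpha$ by $\alpha\gamma$ and repeat Step 2-X. Then go to the next $t$. CMPGA (cyclic MPGA) is MPGA in which the index picked at iteration $t$ is $i=t\bmod(N+1)$. Sets. Let $\overline{g}_{\mathcal{X}}>0$ be a constant with $g\le\overline{g}_{\mathcal{X}}$ on $\mathcal{X}$; $\mathcal{X}_{\underline{\alpha}}:=\{z:\mathrm{dist}^2(z,\mathcal{X})\le\overline{g}_{\mathcal{X}}/\underline{\alpha}\}$; $\mathcal{Y}:=\bigcup_{z\in\mathcal{X}_{\underline{\alpha}}}\partial g(z)$; $\mathcal{S}:=\{(x,y)\in\mathcal{X}\times\mathcal{Y}:\eta(x,y)>0\}$.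 *)

theory Defs
  imports "HOL-Analysis.Analysis"
begin

section \<open>Extended-real-valued functions\<close>

text \<open>Functions with values in (-\<infinity>, +\<infinity>] are functions into \<^typ>\<open>ereal\<close>; the value -\<infinity> is
  excluded by properness.  The notions below are relative to a set \<open>S\<close> because the summands
  of a block-separable function live on coordinate subspaces.\<close>

definition effdom :: "('a \<Rightarrow> ereal) \<Rightarrow> 'a set" where
  "effdom \<phi> = {x. \<phi> x < \<infinity>}"

definition proper_on :: "'a set \<Rightarrow> ('a \<Rightarrow> ereal) \<Rightarrow> bool" where
  "proper_on S \<phi> \<longleftrightarrow> (\<forall>x\<in>S. \<phi> x \<noteq> -\<infinity>) \<and> (\<exists>x\<in>S. \<phi> x < \<infinity>)"

definition lsc_on :: "'a::topological_space set \<Rightarrow> ('a \<Rightarrow> ereal) \<Rightarrow> bool" where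
  "lsc_on S \<phi> \<longleftrightarrow> (\<forall>x\<in>S. \<phi> x \<le> Liminf (at x within S) \<phi>)"

definition prox_on :: "'a::real_inner set \<Rightarrow> ('a \<Rightarrow> ereal) \<Rightarrow> 'a \<Rightarrow> 'a set" where
  "prox_on S \<phi> x = {z. is_arg_min (\<lambda>z. \<phi> z + ereal ((norm (z - x))\<^sup>2 / 2)) (\<lambda>z. z \<in> S) z}"

abbreviation prox :: "('a::real_inner \<Rightarrow> ereal) \<Rightarrow> 'a \<Rightarrow> 'a set" where
  "prox \<equiv> prox_on UNIV"

definition frechet_subdiff :: "('a::real_inner \<Rightarrow> ereal) \<Rightarrow> 'a \<Rightarrow> 'a set" where
  "frechet_subdiff \<phi> x = {y. x \<in> effdom \<phi> \<and>
     0 \<le> Liminf (at x) (\<lambda>z. (\<phi> z - \<phi> x - ereal (y \<bullet> (z - x))) / ereal (norm (z - x)))}"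

definition convex_subdiff :: "('a::real_inner \<Rightarrow> real) \<Rightarrow> 'a \<Rightarrow> 'a set" where
  "convex_subdiff g x = {y. \<forall>z. g z \<ge> g x + y \<bullet> (z - x)}"

definition conj_fun :: "('a::real_inner \<Rightarrow> real) \<Rightarrow> 'a \<Rightarrow> ereal" where
  "conj_fun g y = (SUP x. ereal (x \<bullet> y - g x))"

text \<open>Only meaningful where \<open>h\<close> is finite near \<open>x\<close> and differentiable at \<open>x\<close>, which
  \<open>loc_lipschitz_differentiable_on\<close> guarantees on an open set.\<close>

definition grad :: "('a::real_inner \<Rightarrow> ereal) \<Rightarrow> 'a \<Rightarrow> 'a" where
  "grad h x = (THE D. GDERIV (\<lambda>z. real_of_ereal (h z)) x :> D)"

definition loc_lipschitz_differentiable_on :: "'a::real_inner set \<Rightarrow> ('a \<Rightarrow> ereal) \<Rightarrow> bool" where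
  "loc_lipschitz_differentiable_on S h \<longleftrightarrow>
     (\<forall>x\<in>S. \<bar>h x\<bar> \<noteq> \<infinity> \<and> (\<lambda>z. real_of_ereal (h z)) differentiable (at x)) \<and>
     (\<forall>x\<in>S. \<exists>U L. open U \<and> x \<in> U \<and>
        (\<forall>u\<in>U \<inter> S. \<forall>v\<in>U \<inter> S. norm (grad h u - grad h v) \<le> L * norm (u - v)))"

section \<open>Blocks of coordinates\<close>

text \<open>A block is a set \<open>J\<close> of coordinates.  The Euclidean space of dimension \<^term>\<open>card J\<close> in
  which the corresponding subvectors live is identified, isometrically, with the subspace of
  the vectors that vanish outside \<open>J\<close>.\<close>

definition block_space :: "'n set \<Rightarrow> (real ^ 'n::finite) set" where
  "block_space J = {v. \<forall>j. j \<notin> J \<longrightarrow> v $ j = 0}"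

definition block :: "'n set \<Rightarrow> real ^ 'n::finite \<Rightarrow> real ^ 'n" where
  "block J x = (\<chi> j. if j \<in> J then x $ j else 0)"

definition replace_block :: "'n set \<Rightarrow> real ^ 'n::finite \<Rightarrow> real ^ 'n \<Rightarrow> real ^ 'n" where
  "replace_block J x v = (\<chi> j. if j \<in> J then v $ j else x $ j)"

definition block_partition :: "nat \<Rightarrow> (nat \<Rightarrow> 'n::finite set) \<Rightarrow> bool" where
  "block_partition N B \<longleftrightarrow> disjoint_family_on B {1..N} \<and> (\<Union>i\<in>{1..N}. B i) = UNIV \<and>
     (\<forall>i\<in>{1..N}. B i \<noteq> {})"

section \<open>The fractional program\<close>

definition zeta :: "('a \<Rightarrow> ereal) \<Rightarrow> ('a \<Rightarrow> ereal) \<Rightarrow> 'a \<Rightarrow> ereal" where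
  "zeta f h x = f x + h x"

definition eta :: "('a::real_inner \<Rightarrow> real) \<Rightarrow> 'a \<Rightarrow> 'a \<Rightarrow> ereal" where
  "eta g x y = ereal (x \<bullet> y) - conj_fun g y"

definition Omega :: "('a \<Rightarrow> real) \<Rightarrow> 'a set" where
  "Omega g = {x. g x \<noteq> 0}"

definition F_obj :: "('a \<Rightarrow> ereal) \<Rightarrow> ('a \<Rightarrow> real) \<Rightarrow> ('a \<Rightarrow> ereal) \<Rightarrow> 'a \<Rightarrow> ereal" where
  "F_obj f g h x = (if x \<in> Omega g \<inter> effdom f then zeta f h x / ereal (g x) else \<infinity>)"

definition Q_obj ::
  "('a::real_inner \<Rightarrow> ereal) \<Rightarrow> ('a \<Rightarrow> real) \<Rightarrow> ('a \<Rightarrow> ereal) \<Rightarrow> 'a \<Rightarrow> 'a \<Rightarrow> ereal" where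
  "Q_obj f g h x y =
     (if x \<in> effdom f \<and> y \<in> effdom (conj_fun g) \<and> eta g x y > 0
      then zeta f h x / eta g x y else \<infinity>)"

text \<open>On the effective domain of \<^term>\<open>F_obj f g h\<close> the value is finite as soon as \<open>f\<close> is proper
  and \<open>h\<close> is finite on \<^term>\<open>Omega g\<close>, so \<^const>\<open>real_of_ereal\<close> is a mere type conversion.\<close>

definition critical_point ::
  "('a::real_inner \<Rightarrow> ereal) \<Rightarrow> ('a \<Rightarrow> real) \<Rightarrow> ('a \<Rightarrow> ereal) \<Rightarrow> 'a \<Rightarrow> bool" where
  "critical_point f g h x \<longleftrightarrow> x \<in> effdom (F_obj f g h) \<and>
     0 \<in> {u + grad h x - real_of_ereal (F_obj f g h x) *\<^sub>R w | u w.
            u \<in> frechet_subdiff f x \<and> w \<in> convex_subdiff g x}"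

section \<open>The algorithm\<close>

text \<open>\<open>Q\<close> is the sequence of objective values; natural-number subtraction truncates, so
  \<^term>\<open>t - M\<close> is the positive part of the difference.\<close>

definition ls_index :: "(nat \<Rightarrow> ereal) \<Rightarrow> nat \<Rightarrow> nat \<Rightarrow> nat" where
  "ls_index Q M t = Max {j. j \<le> t \<and> Q j = Max (Q ` {t - M..t})}"

definition step_Y ::
  "('a::real_inner \<Rightarrow> real) \<Rightarrow> real \<Rightarrow> real \<Rightarrow> 'a \<Rightarrow> 'a \<Rightarrow> 'a \<Rightarrow> 'a \<Rightarrow> bool" where
  "step_Y g \<alpha>min \<alpha>max x y x' y' \<longleftrightarrow> x' = x \<and>
     (\<exists>\<alpha>\<in>{\<alpha>min..\<alpha>max}. y' \<in> prox (\<lambda>v. ereal \<alpha> * conj_fun g v) (y + \<alpha> *\<^sub>R x))"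

definition ls_accept ::
  "('a::real_inner \<Rightarrow> ereal) \<Rightarrow> ('a \<Rightarrow> real) \<Rightarrow> ('a \<Rightarrow> ereal) \<Rightarrow> real \<Rightarrow> ereal \<Rightarrow> 'a \<Rightarrow> 'a \<Rightarrow> 'a \<Rightarrow> bool"
where
  "ls_accept f g h \<sigma> Ql x y x' \<longleftrightarrow>
     zeta f h x' + ereal (\<sigma> / 2 * (norm (x' - x))\<^sup>2) \<le> Ql * eta g x' y"

text \<open>\<open>J\<close> is the active block, \<open>fi\<close> its summand of \<open>f\<close>, \<open>Qt\<close> the current objective value and
  \<open>Ql\<close> the reference value of the line search.  The point \<open>z k\<close> is the candidate subvector
  computed after \<open>k\<close> reductions of the step size; the search stops at the first
  accepted candidate \<open>z m\<close>.\<close>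

definition step_X ::
  "('n::finite) set \<Rightarrow> (real ^ 'n \<Rightarrow> ereal) \<Rightarrow>
   (real ^ 'n \<Rightarrow> ereal) \<Rightarrow> (real ^ 'n \<Rightarrow> real) \<Rightarrow> (real ^ 'n \<Rightarrow> ereal) \<Rightarrow>
   real \<Rightarrow> real \<Rightarrow> real \<Rightarrow> real \<Rightarrow> ereal \<Rightarrow> ereal \<Rightarrow>
   real ^ 'n \<Rightarrow> real ^ 'n \<Rightarrow> real ^ 'n \<Rightarrow> real ^ 'n \<Rightarrow> bool" where
  "step_X J fi f g h \<alpha>min \<alpha>max \<sigma> \<gamma> Qt Ql x y x' y' \<longleftrightarrow> y' = y \<and>
     (\<exists>\<alpha>\<in>{\<alpha>min..\<alpha>max}. \<exists>m z.
        (\<forall>k\<le>m. z k \<in> prox_on (block_space J) (\<lambda>v. ereal (\<alpha> * \<gamma> ^ k) * fi v)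
                 (block J x - (\<alpha> * \<gamma> ^ k) *\<^sub>R block J (grad h x)
                   + (\<alpha> * \<gamma> ^ k * real_of_ereal Qt) *\<^sub>R block J y)) \<and>
        (\<forall>k<m. \<not> ls_accept f g h \<sigma> Ql x y (replace_block J x (z k))) \<and>
        ls_accept f g h \<sigma> Ql x y (replace_block J x (z m)) \<and>
        x' = replace_block J x (z m))"

text \<open>\<^term>\<open>idx t\<close> is the index picked at iteration \<open>t\<close>; the blocks carry the indices
  \<open>1, \<dots>, N\<close>.\<close>

definition MPGA ::
  "nat \<Rightarrow> (nat \<Rightarrow> ('n::finite) set) \<Rightarrow> (nat \<Rightarrow> real ^ 'n \<Rightarrow> ereal) \<Rightarrow>
   (real ^ 'n \<Rightarrow> ereal) \<Rightarrow> (real ^ 'n \<Rightarrow> real) \<Rightarrow> (real ^ 'n \<Rightarrow> ereal) \<Rightarrow>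
   real \<Rightarrow> real \<Rightarrow> real \<Rightarrow> real \<Rightarrow> nat \<Rightarrow> (nat \<Rightarrow> nat) \<Rightarrow>
   (nat \<Rightarrow> real ^ 'n) \<Rightarrow> (nat \<Rightarrow> real ^ 'n) \<Rightarrow> bool" where
  "MPGA N B fs f g h \<alpha>min \<alpha>max \<sigma> \<gamma> M idx x y \<longleftrightarrow>
     x 0 \<in> effdom (F_obj f g h) \<and> y 0 \<in> convex_subdiff g (x 0) \<and>
     (\<forall>t. idx t \<le> N \<and>
        (let Q = (\<lambda>s. Q_obj f g h (x s) (y s)); i = idx t in
         if i = 0 then step_Y g \<alpha>min \<alpha>max (x t) (y t) (x (Suc t)) (y (Suc t))
         else step_X (B i) (fs i) f g h \<alpha>min \<alpha>max \<sigma> \<gamma> (Q t) (Q (ls_index Q M t))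
                (x t) (y t) (x (Suc t)) (y (Suc t))))"

definition CMPGA ::
  "nat \<Rightarrow> (nat \<Rightarrow> ('n::finite) set) \<Rightarrow> (nat \<Rightarrow> real ^ 'n \<Rightarrow> ereal) \<Rightarrow>
   (real ^ 'n \<Rightarrow> ereal) \<Rightarrow> (real ^ 'n \<Rightarrow> real) \<Rightarrow> (real ^ 'n \<Rightarrow> ereal) \<Rightarrow>
   real \<Rightarrow> real \<Rightarrow> real \<Rightarrow> real \<Rightarrow> nat \<Rightarrow>
   (nat \<Rightarrow> real ^ 'n) \<Rightarrow> (nat \<Rightarrow> real ^ 'n) \<Rightarrow> bool" where
  "CMPGA N B fs f g h \<alpha>min \<alpha>max \<sigma> \<gamma> M x y \<longleftrightarrow>
     MPGA N B fs f g h \<alpha>min \<alpha>max \<sigma> \<gamma> M (\<lambda>t. t mod (N + 1)) x y"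

section \<open>The sets in the convergence statement\<close>

definition level_set ::
  "('a \<Rightarrow> ereal) \<Rightarrow> ('a \<Rightarrow> real) \<Rightarrow> ('a \<Rightarrow> ereal) \<Rightarrow> 'a \<Rightarrow> 'a set" where
  "level_set f g h x0 = {x. F_obj f g h x \<le> F_obj f g h x0}"

definition enlarged_set :: "'a::metric_space set \<Rightarrow> real \<Rightarrow> real \<Rightarrow> 'a set" where
  "enlarged_set X gbar \<alpha>min = {z. (infdist z X)\<^sup>2 \<le> gbar / \<alpha>min}"

definition dual_set :: "('a::real_inner \<Rightarrow> real) \<Rightarrow> 'a set \<Rightarrow> real \<Rightarrow> real \<Rightarrow> 'a set" where
  "dual_set g X gbar \<alpha>min = (\<Union>z\<in>enlarged_set X gbar \<alpha>min. convex_subdiff g z)"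

definition S_set :: "('a::real_inner \<Rightarrow> real) \<Rightarrow> 'a set \<Rightarrow> real \<Rightarrow> real \<Rightarrow> ('a \<times> 'a) set" where
  "S_set g X gbar \<alpha>min = {(x, y) \<in> X \<times> dual_set g X gbar \<alpha>min. eta g x y > 0}"

end

theory Submission
  imports Defs
begin

text \<open>Along a run, \<open>\<eta>\<close> can only increase in a dual step, and a dual step that leaves \<open>\<eta>\<close> small
  is short, which makes \<open>\<eta>\<close> close to \<open>g\<close>; since every cycle contains a dual step and an
  accepted primal step cannot make \<open>\<eta>\<close> collapse, \<open>\<eta>\<close> stays away from zero.  If \<open>f + h\<close>
  vanishes at the accumulation point, criticality is Fermat's rule.  Otherwise the nonmonotone line
  search forces the steps to tend to zero, so that all iterates of a cycle share the accumulation
  point; the line search keeps the step sizes bounded below near it, and the optimality inequalities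
  of the proximal steps pass to the limit, the dual ones through the closed graph of \<open>\<partial>g\<close>, the
  primal ones by lower semicontinuity of the summands.\<close>

section \<open>Subgradients and conjugates of finite convex functions\<close>

text \<open>The order of the estimates is forced. That the steps vanish rests on uniform continuity
  of the quotient \<open>num / eta_real\<close> along the run, which is available only where the
  denominator is bounded away from zero. The lower bound on \<open>e\<close> therefore has to come
  beforehand, from single-step estimates. The descent inequality is multiplicative in
  \<open>q (Suc t)\<close> because a dual step keeps the numerator and gains only in the
  denominator. It controls no step length where \<open>q\<close> approaches zero, hence the case
  distinction on \<open>num xs\<close>. In the zero case nothing is shown about \<open>ys\<close>
  being a subgradient at \<open>xs\<close>; the factor \<open>F_obj f g h xs\<close> in the dual
  conclusion then vanishes.\<close>

lemma convex_subdiff_nonempty: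
  fixes g :: "'a::euclidean_space \<Rightarrow> real"
  assumes "convex_on UNIV g"
  shows "convex_subdiff g x \<noteq> {}"
proof -
  \<comment> \<open>The strict epigraph is disjoint from the point \<open>(x, g x)\<close>, so plain
    separation of disjoint convex sets applies.\<close>
  define S where "S = {(z, r). g z < r}"
  have "convex S"
    unfolding convex_def
  proof (clarify)
    fix a b c d and u v :: real
    assume A: "(a, b) \<in> S" "(c, d) \<in> S" and uv: "0 \<le> u" "0 \<le> v" "u + v = 1"
    have "g (u *\<^sub>R a + v *\<^sub>R c) \<le> u * g a + v * g c"
      using assms uv unfolding convex_on_def by blast
    moreover have "u * g a + v * g c < u * b + v * d"
    proof (cases "u = 0")
      case True
      then show ?thesis using A uv by (simp add: S_def)
    next
      case False
      then have "u * g a < u * b" using A uv by (simp add: S_def)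
      moreover have "v * g c \<le> v * d" using A uv by (simp add: S_def mult_left_mono)
      ultimately show ?thesis by linarith
    qed
    ultimately show "u *\<^sub>R (a, b) + v *\<^sub>R (c, d) \<in> S" by (simp add: S_def)
  qed
  moreover have "(x, g x + 1) \<in> S" by (simp add: S_def)
  moreover have "S \<inter> {(x, g x)} = {}" by (simp add: S_def)
  ultimately obtain a c where ac: "a \<noteq> 0" "\<forall>z\<in>S. a \<bullet> z \<le> c" "\<forall>z\<in>{(x, g x)}. c \<le> a \<bullet> z"
    using separating_hyperplane_sets[of S "{(x, g x)}"] by (metis convex_singleton empty_iff insert_not_empty)
  obtain p s where ps: "a = (p, s)" by force
  have sep: "p \<bullet> z + s * r \<le> p \<bullet> x + s * g x" if "g z < r" for z r
  proof -
    have "a \<bullet> (z, r) \<le> c" using ac(2) that by (auto simp: S_def)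
    also have "c \<le> a \<bullet> (x, g x)" using ac(3) by simp
    finally show ?thesis by (simp add: ps)
  qed
  have "s \<le> 0" using sep[of x "g x + 1"] by (simp add: algebra_simps)
  \<comment> \<open>Finiteness of \<open>g\<close> at \<open>x + p\<close> excludes a vertical
    hyperplane: with \<open>s = 0\<close>, testing there forces
    \<open>p \<bullet> p \<le> 0\<close>, and the whole normal would vanish.\<close>
  moreover have "s \<noteq> 0"
  proof
    assume "s = 0"
    then have "p \<bullet> p \<le> 0" using sep[of "x + p" "g (x + p) + 1"] by (simp add: inner_add_right)
    then have "p = 0" by (metis inner_eq_zero_iff inner_ge_zero order_antisym)
    then show False using ac(1) ps \<open>s = 0\<close> by (simp add: zero_prod_def)
  qed
  ultimately have s: "s < 0" by simp
  have "g z \<ge> g x + (p /\<^sub>R (- s)) \<bullet> (z - x)" for z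
  proof (rule dense_ge)
    fix r assume "g z < r"
    then have "p \<bullet> (z - x) \<le> (- s) * (r - g x)"
      using sep[of z r] by (simp add: algebra_simps)
    then have "p \<bullet> (z - x) / (- s) \<le> r - g x" using s by (simp add: field_simps)
    then show "g x + (p /\<^sub>R (- s)) \<bullet> (z - x) \<le> r" by (simp add: divide_inverse algebra_simps)
  qed
  then have "p /\<^sub>R (- s) \<in> convex_subdiff g x" unfolding convex_subdiff_def by blast
  then show ?thesis by blast
qed

lemma convex_subdiff_closed:
  fixes g :: "'a::real_inner \<Rightarrow> real"
  assumes g: "continuous_on UNIV g"
    and z: "z \<longlonglongrightarrow> z0" and y: "y \<longlonglongrightarrow> y0"
    and sub: "\<forall>\<^sub>F k in sequentially. y k \<in> convex_subdiff g (z k)"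
  shows "y0 \<in> convex_subdiff g z0"
  unfolding convex_subdiff_def
proof (intro CollectI allI)
  fix v
  have gz: "(\<lambda>k. g (z k)) \<longlonglongrightarrow> g z0"
    using continuous_on_tendsto_compose[OF g z] by simp
  have "(\<lambda>k. g (z k) + y k \<bullet> (v - z k)) \<longlonglongrightarrow> g z0 + y0 \<bullet> (v - z0)"
    by (intro tendsto_intros gz z y)
  moreover have "\<forall>\<^sub>F k in sequentially. g (z k) + y k \<bullet> (v - z k) \<le> g v"
    using sub by eventually_elim (auto simp: convex_subdiff_def)
  ultimately show "g z0 + y0 \<bullet> (v - z0) \<le> g v"
    by (intro tendsto_upperbound) auto
qed

text \<open>Testing at the unit displacement \<open>z + sgn y\<close> bounds \<open>norm y\<close>
  by \<open>g (z + sgn y) - g z\<close>, and \<open>g\<close> is bounded on a ball whose radius is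
  larger by one.\<close>

lemma convex_subdiff_bounded:
  fixes g :: "'a::euclidean_space \<Rightarrow> real"
  assumes "convex_on UNIV g" "bounded K"
  shows "bounded (\<Union>z\<in>K. convex_subdiff g z)"
proof -
  obtain R where R: "\<And>z. z \<in> K \<Longrightarrow> norm z \<le> R" using assms(2) by (auto simp: bounded_iff)
  have "continuous_on (cball 0 (R + 1)) g"
    using convex_on_continuous[OF open_UNIV assms(1)] continuous_on_subset by blast
  then have "bounded (g ` cball 0 (R + 1))"
    using compact_continuous_image compact_imp_bounded compact_cball by blast
  then obtain C where "\<forall>z\<in>cball 0 (R + 1). \<bar>g z\<bar> \<le> C"
    by (auto simp: bounded_iff)
  then have C: "\<bar>g z\<bar> \<le> C" if "norm z \<le> R + 1" for z
    using that by simp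
  have "norm y \<le> 2 * \<bar>C\<bar>" if z: "z \<in> K" and y: "y \<in> convex_subdiff g z" for y z
  proof (cases "y = 0")
    case False
    have "g z + y \<bullet> (z + sgn y - z) \<le> g (z + sgn y)"
      using y unfolding convex_subdiff_def by blast
    moreover have "y \<bullet> sgn y = norm y"
      using False by (simp add: sgn_div_norm power2_norm_eq_inner[symmetric] power2_eq_square)
    moreover have "norm (z + sgn y) \<le> R + 1"
      using norm_triangle_ineq[of z "sgn y"] R[OF z] False by (simp add: norm_sgn)
    ultimately show ?thesis
      using C[of z] C[of "z + sgn y"] R[OF z] by simp
  qed simp
  then show ?thesis by (auto simp: bounded_iff)
qed

lemma compact_convex_subdiff_image:
  fixes g :: "'a::euclidean_space \<Rightarrow> real"
  assumes g: "convex_on UNIV g" and K: "compact K"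
  shows "compact (\<Union>z\<in>K. convex_subdiff g z)"
  unfolding compact_eq_bounded_closed
proof
  show "bounded (\<Union>z\<in>K. convex_subdiff g z)"
    using convex_subdiff_bounded[OF g] K compact_imp_bounded by blast
  show "closed (\<Union>z\<in>K. convex_subdiff g z)"
    unfolding closed_sequential_limits
  proof clarify
    fix y l assume y: "\<forall>n. y n \<in> (\<Union>z\<in>K. convex_subdiff g z)" and l: "y \<longlonglongrightarrow> l"
    then obtain z where z: "\<And>n. z n \<in> K" "\<And>n. y n \<in> convex_subdiff g (z n)"
      by (simp add: UN_iff) metis
    obtain z0 s where s: "z0 \<in> K" "strict_mono s" "(z \<circ> s) \<longlonglongrightarrow> z0"
      using K z(1) unfolding compact_def by blast
    have "l \<in> convex_subdiff g z0"
      by (rule convex_subdiff_closed[OF convex_on_continuous[OF open_UNIV g] s(3) LIMSEQ_subseq_LIMSEQ[OF l s(2)]])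
        (simp add: z(2))
    then show "l \<in> (\<Union>z\<in>K. convex_subdiff g z)" using s(1) by blast
  qed
qed

lemma conj_fun_upper: "ereal (x \<bullet> y - g x) \<le> conj_fun g y"
  unfolding conj_fun_def by (rule SUP_upper) simp

lemma conj_fun_not_MInf: "conj_fun g y \<noteq> - \<infinity>"
  using conj_fun_upper[of 0 y g] by auto

text \<open>The equality case of the Fenchel-Young inequality \<open>conj_fun_upper\<close>.\<close>

lemma conj_fun_subdiff: "y \<in> convex_subdiff g x \<longleftrightarrow> conj_fun g y = ereal (x \<bullet> y - g x)"
proof
  assume "y \<in> convex_subdiff g x"
  then have "z \<bullet> y - g z \<le> x \<bullet> y - g x" for z
    unfolding convex_subdiff_def mem_Collect_eq
    by (drule_tac x = z in spec) (simp add: inner_diff_right inner_commute)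
  then have "conj_fun g y \<le> ereal (x \<bullet> y - g x)"
    unfolding conj_fun_def by (intro SUP_least) simp
  then show "conj_fun g y = ereal (x \<bullet> y - g x)"
    using conj_fun_upper[of x y g] by simp
next
  assume A: "conj_fun g y = ereal (x \<bullet> y - g x)"
  have "z \<bullet> y - g z \<le> x \<bullet> y - g x" for z
    using conj_fun_upper[of z y g] A by simp
  then show "y \<in> convex_subdiff g x"
    unfolding convex_subdiff_def by (auto simp: inner_diff_right inner_commute algebra_simps)
qed

text \<open>Meaningful on the effective domain of the conjugate; where the conjugate is infinite,
  \<open>real_of_ereal\<close> returns the default 0.\<close>

definition conj_real :: "('a::real_inner \<Rightarrow> real) \<Rightarrow> 'a \<Rightarrow> real" where
  "conj_real g y = real_of_ereal (conj_fun g y)"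

definition eta_real :: "('a::real_inner \<Rightarrow> real) \<Rightarrow> 'a \<Rightarrow> 'a \<Rightarrow> real" where
  "eta_real g x y = x \<bullet> y - conj_real g y"

lemma conj_fun_eq_conj_real: "y \<in> effdom (conj_fun g) \<Longrightarrow> conj_fun g y = ereal (conj_real g y)"
  using conj_fun_not_MInf[of g y] by (cases "conj_fun g y") (auto simp: conj_real_def effdom_def)

lemma conj_real_subdiff: "y \<in> convex_subdiff g x \<Longrightarrow> conj_real g y = x \<bullet> y - g x"
  by (simp add: conj_real_def conj_fun_subdiff)

lemma convex_subdiff_effdom: "y \<in> convex_subdiff g x \<Longrightarrow> y \<in> effdom (conj_fun g)"
  by (simp add: conj_fun_subdiff effdom_def)

lemma eta_eq_eta_real: "y \<in> effdom (conj_fun g) \<Longrightarrow> eta g x y = ereal (eta_real g x y)"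
  by (simp add: eta_def eta_real_def conj_fun_eq_conj_real)

lemma conj_real_upper: "y \<in> effdom (conj_fun g) \<Longrightarrow> x \<bullet> y - g x \<le> conj_real g y"
  using conj_fun_upper[of x y g] by (simp add: conj_fun_eq_conj_real)

lemma eta_real_le: "y \<in> effdom (conj_fun g) \<Longrightarrow> eta_real g x y \<le> g x"
  using conj_real_upper[of y g x] by (simp add: eta_real_def)

lemma eta_real_subdiff: "y \<in> convex_subdiff g x \<Longrightarrow> eta_real g x y = g x"
  by (simp add: eta_real_def conj_real_subdiff)

text \<open>The conjugate term does not involve the primal argument, so linearizing the denominator
  in a primal step is exact and only \<open>h\<close> contributes a second-order error.\<close>

lemma eta_real_affine: "eta_real g x' y = eta_real g x y + y \<bullet> (x' - x)"
  by (simp add: eta_real_def inner_diff_right inner_commute)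

text \<open>Subdifferential inversion: subtract the Fenchel-Young equality at \<open>y\<close> from
  the inequality at \<open>v\<close>, both taken at \<open>z\<close>.\<close>

lemma conj_real_subgradient:
  assumes "y \<in> convex_subdiff g z" "v \<in> effdom (conj_fun g)"
  shows "conj_real g y + z \<bullet> (v - y) \<le> conj_real g v"
  using conj_real_upper[OF assms(2), of z] conj_real_subdiff[OF assms(1)]
  by (simp add: inner_diff_right)

text \<open>The base points \<open>z\<close> and \<open>z'\<close> are subgradients of the
  conjugate, so a bound on them is a Lipschitz constant; the two signs come from exchanging the
  roles of \<open>y\<close> and \<open>y'\<close>.\<close>

lemma conj_real_lipschitz:
  assumes "y \<in> convex_subdiff g z" "y' \<in> convex_subdiff g z'" "norm z \<le> R" "norm z' \<le> R"
  shows "\<bar>conj_real g y - conj_real g y'\<bar> \<le> R * norm (y - y')"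
proof -
  have "conj_real g y + z \<bullet> (y' - y) \<le> conj_real g y'"
    and "conj_real g y' + z' \<bullet> (y - y') \<le> conj_real g y"
    using assms conj_real_subgradient convex_subdiff_effdom by blast+
  moreover have "\<bar>z \<bullet> (y' - y)\<bar> \<le> R * norm (y - y')" "\<bar>z' \<bullet> (y - y')\<bar> \<le> R * norm (y - y')"
    using assms Cauchy_Schwarz_ineq2[of z "y' - y"] Cauchy_Schwarz_ineq2[of z' "y - y'"]
      mult_right_mono[of "norm z" R "norm (y - y')"] mult_right_mono[of "norm z'" R "norm (y - y')"]
    by (simp_all add: norm_minus_commute)
  ultimately show ?thesis by linarith
qed

section \<open>Proximal steps\<close>

text \<open>Dividing by \<open>s\<close> and letting \<open>s\<close> tend to zero. It turns
  minimality along a segment into a first-order condition without differentiating.\<close>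

lemma nonneg_of_quadratic_nonneg:
  fixes A B :: real
  assumes "\<And>s. 0 < s \<Longrightarrow> s \<le> 1 \<Longrightarrow> 0 \<le> s * A + s\<^sup>2 * B"
  shows "0 \<le> A"
proof (rule ccontr)
  assume "\<not> 0 \<le> A"
  \<comment> \<open>Chosen so that \<open>s * \<bar>B\<bar>\<close> stays below
    \<open>- A / 2\<close>, which keeps \<open>A + s * B\<close> negative.\<close>
  define s where "s = min 1 (- A / (2 * (\<bar>B\<bar> + 1)))"
  have s: "0 < s" "s \<le> 1" using \<open>\<not> 0 \<le> A\<close> by (auto simp: s_def intro!: divide_neg_pos)
  have "s * (2 * (\<bar>B\<bar> + 1)) \<le> - A"
    using mult_right_mono[of s "- A / (2 * (\<bar>B\<bar> + 1))" "2 * (\<bar>B\<bar> + 1)"]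
    by (simp add: s_def)
  moreover have "s * B \<le> s * \<bar>B\<bar>" using s by (simp add: mult_left_mono)
  moreover have "s * (2 * (\<bar>B\<bar> + 1)) = 2 * (s * \<bar>B\<bar>) + 2 * s" by (simp add: algebra_simps)
  ultimately have "A + s * B < 0" using s \<open>\<not> 0 \<le> A\<close> by linarith
  then have "s * (A + s * B) < 0" using s by (simp add: mult_pos_neg)
  then show False using assms[OF s] by (simp add: algebra_simps power2_eq_square)
qed

text \<open>Moreau's identity: optimality puts \<open>(w - y) /\<^sub>R a\<close> into the
  subdifferential of the conjugate at \<open>y\<close>, and inversion gives the claim.\<close>

lemma prox_conj_subdiff:
  fixes g :: "'a::euclidean_space \<Rightarrow> real"
  assumes g: "convex_on UNIV g" and a: "0 < a"
    and y: "y \<in> prox (\<lambda>v. ereal a * conj_fun g v) w"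
  shows "y \<in> convex_subdiff g ((w - y) /\<^sub>R a)"
proof -
  define z where "z = (w - y) /\<^sub>R a"
  \<comment> \<open>This single competitor is enough: its conjugate value is
    \<open>z \<bullet> p - g z\<close>, so the first-order condition in the direction
    \<open>p - y\<close> collapses to the Fenchel-Young equality for \<open>y\<close> at
    \<open>z\<close>.\<close>
  obtain p where p: "p \<in> convex_subdiff g z" using convex_subdiff_nonempty[OF g] by blast
  have min: "ereal a * conj_fun g y + ereal ((norm (y - w))\<^sup>2 / 2)
      \<le> ereal a * conj_fun g v + ereal ((norm (v - w))\<^sup>2 / 2)" for v
    using y by (auto simp: prox_on_def is_arg_min_def not_less)
  have fin: "y \<in> effdom (conj_fun g)"
    using min[of p] a conj_fun_eq_conj_real[OF convex_subdiff_effdom[OF p]]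
    by (cases "conj_fun g y") (auto simp: effdom_def)
  let ?a = "conj_real g y" and ?b = "conj_real g p"
  have "0 \<le> s * (a * (?b - ?a) + (y - w) \<bullet> (p - y)) + s\<^sup>2 * ((norm (p - y))\<^sup>2 / 2)"
    if s: "0 < s" "s \<le> 1" for s
  proof -
    define v where "v = y + s *\<^sub>R (p - y)"
    have "conj_fun g v \<le> ereal ((1 - s) * ?a + s * ?b)"
      unfolding conj_fun_def
    proof (rule SUP_least)
      fix u
      have "(1 - s) * (u \<bullet> y - g u) + s * (u \<bullet> p - g u) \<le> (1 - s) * ?a + s * ?b"
        using s conj_real_upper[OF fin, of u] conj_real_upper[OF convex_subdiff_effdom[OF p], of u]
        by (intro add_mono mult_left_mono) auto
      moreover have "u \<bullet> v - g u = (1 - s) * (u \<bullet> y - g u) + s * (u \<bullet> p - g u)"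
        by (simp add: v_def inner_add_right inner_diff_right algebra_simps)
      ultimately show "ereal (u \<bullet> v - g u) \<le> ereal ((1 - s) * ?a + s * ?b)" by simp
    qed
    then have "ereal a * conj_fun g v \<le> ereal a * ereal ((1 - s) * ?a + s * ?b)"
      using a by (intro ereal_mult_left_mono) auto
    then have "ereal a * conj_fun g v + ereal ((norm (v - w))\<^sup>2 / 2)
        \<le> ereal (a * ((1 - s) * ?a + s * ?b) + (norm (v - w))\<^sup>2 / 2)"
      using add_right_mono[of "ereal a * conj_fun g v" _ "ereal ((norm (v - w))\<^sup>2 / 2)"] by force
    then have "a * ?a + (norm (y - w))\<^sup>2 / 2 \<le> a * ((1 - s) * ?a + s * ?b) + (norm (v - w))\<^sup>2 / 2"
      using order.trans[OF min[of v]] by (force simp: conj_fun_eq_conj_real[OF fin])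
    moreover have "v - w = (y - w) + s *\<^sub>R (p - y)" by (simp add: v_def)
    then have "(norm (v - w))\<^sup>2 = (norm (y - w))\<^sup>2 + 2 * s * ((y - w) \<bullet> (p - y)) + s\<^sup>2 * (norm (p - y))\<^sup>2"
      by (simp only: power2_norm_eq_inner)
        (simp add: inner_add_left inner_add_right inner_commute power2_eq_square algebra_simps)
    ultimately show ?thesis by (simp add: field_simps)
  qed
  then have "0 \<le> a * (?b - ?a) + (y - w) \<bullet> (p - y)" by (rule nonneg_of_quadratic_nonneg)
  moreover have "(y - w) \<bullet> (p - y) = - (a * (z \<bullet> (p - y)))"
    using a by (simp only: inner_scaleR_left[symmetric] z_def) (simp add: inner_diff_left)
  ultimately have "0 \<le> a * ((?b - ?a) - z \<bullet> (p - y))" by (simp add: algebra_simps)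
  then have "?a + z \<bullet> (p - y) \<le> ?b" using a by (simp add: zero_le_mult_iff)
  then have "?a \<le> z \<bullet> y - g z"
    using conj_real_subdiff[OF p] by (simp add: inner_diff_right)
  then have "conj_fun g y = ereal (z \<bullet> y - g z)"
    using conj_fun_upper[of z y g] by (simp add: conj_fun_eq_conj_real[OF fin])
  then show ?thesis using conj_fun_subdiff z_def by blast
qed

text \<open>The base point of the subgradient \<open>y'\<close> is a subgradient of the conjugate at
  \<open>y'\<close>. Testing its inequality at the old \<open>y\<close> leaves the squared step as
  the gain.\<close>

lemma eta_real_dual_step:
  assumes "a > 0" "y' \<in> convex_subdiff g (x + (y - y') /\<^sub>R a)" "y \<in> effdom (conj_fun g)"
  shows "eta_real g x y + (norm (y' - y))\<^sup>2 / a \<le> eta_real g x y'"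
  using conj_real_subgradient[OF assms(2,3)] assms(1)
  by (simp add: eta_real_def inner_add_left inner_diff_right inner_diff_left power2_norm_eq_inner
      inner_commute divide_inverse algebra_simps)

text \<open>A small value of \<open>\<eta>(x, y')\<close> forces a short step, and then \<open>\<eta>(x, y')\<close> is close to \<open>g(x)\<close>.\<close>

lemma eta_real_dual_step_lower:
  assumes a: "0 < amin" "amin \<le> a" and y': "y' \<in> convex_subdiff g (x + (y - y') /\<^sub>R a)"
    and y: "y \<in> effdom (conj_fun g)" "0 \<le> eta_real g x y"
    and p: "p \<in> convex_subdiff g x" and D: "0 < D" "norm p \<le> D" "norm y' \<le> D"
    and gm: "0 < gm" "gm \<le> g x"
  shows "min (gm / 2) (amin * (gm / (4 * D))\<^sup>2) \<le> eta_real g x y'"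
proof -
  define d where "d = norm (y' - y) / a"
  define z where "z = x + (y - y') /\<^sub>R a"
  have nz: "norm (z - x) = d" using a by (simp add: z_def d_def norm_minus_commute divide_inverse)
  have a0: "0 < a" using a by simp
  show ?thesis
  \<comment> \<open>At this threshold the ascent of the dual step alone gives the second bound;
    below it, the two error terms are at most \<open>D * d \<le> gm / 4\<close> each and leave
    \<open>gm / 2\<close>.\<close>
  proof (cases "gm / (4 * D) \<le> d")
    case True
    have "amin * (gm / (4 * D))\<^sup>2 \<le> a * d\<^sup>2"
      using True a gm D by (intro mult_mono power_mono) auto
    also have "a * d\<^sup>2 = (norm (y' - y))\<^sup>2 / a" using a0 by (simp add: d_def power2_eq_square)
    also have "\<dots> \<le> eta_real g x y'" using eta_real_dual_step[OF a0 y' y(1)] y(2) by simp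
    finally show ?thesis by simp
  next
    case False
    \<comment> \<open>\<open>\<eta>\<close> equals \<open>g\<close> at the base point
      \<open>z\<close> of the subgradient \<open>y'\<close> and is affine from there to
      \<open>x\<close>.\<close>
    have *: "eta_real g x y' = g z - y' \<bullet> (z - x)"
      using eta_real_affine[of g x y' z] eta_real_subdiff[of y' g z] y'
      by (simp add: z_def inner_diff_right)
    have "g x + p \<bullet> (z - x) \<le> g z" using p by (auto simp: convex_subdiff_def)
    moreover have "\<bar>p \<bullet> (z - x)\<bar> \<le> D * d" "\<bar>y' \<bullet> (z - x)\<bar> \<le> D * d"
      using Cauchy_Schwarz_ineq2[of p "z - x"] Cauchy_Schwarz_ineq2[of y' "z - x"] D
        mult_right_mono[of "norm p" D d] mult_right_mono[of "norm y'" D d] nz a0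
      by (auto simp: d_def)
    moreover have "D * d \<le> gm / 4" using False D by (simp add: field_simps)
    ultimately show ?thesis using * gm by linarith
  qed
qed

text \<open>Expanding both squares around \<open>p\<close> produces the same constant
  \<open>a\<^sup>2 * (norm w)\<^sup>2\<close>, which cancels; division by \<open>a\<close> leaves
  the linearized model with its quadratic penalty. Comparison with one point of finite value makes
  the minimizer's value finite.\<close>

lemma prox_on_gradient_step:
  fixes w :: "'a::real_inner"
  assumes a: "0 < a" and S: "proper_on S \<phi>"
    and z: "z \<in> prox_on S (\<lambda>v. ereal a * \<phi> v) (p - a *\<^sub>R w)"
  shows "z \<in> S" "\<bar>\<phi> z\<bar> \<noteq> \<infinity>"
    and "\<lbrakk>v \<in> S; \<phi> v < \<infinity>\<rbrakk> \<Longrightarrow>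
      real_of_ereal (\<phi> z) + w \<bullet> (z - p) + (norm (z - p))\<^sup>2 / (2 * a)
        \<le> real_of_ereal (\<phi> v) + w \<bullet> (v - p) + (norm (v - p))\<^sup>2 / (2 * a)"
proof -
  let ?c = "p - a *\<^sub>R w"
  show zS: "z \<in> S" using z by (simp add: prox_on_def is_arg_min_def)
  have min: "ereal a * \<phi> z + ereal ((norm (z - ?c))\<^sup>2 / 2)
      \<le> ereal a * \<phi> v + ereal ((norm (v - ?c))\<^sup>2 / 2)" if "v \<in> S" for v
    using z that by (auto simp: prox_on_def is_arg_min_def not_less)
  obtain v0 where v0: "v0 \<in> S" "\<phi> v0 < \<infinity>" and nm: "\<And>v. v \<in> S \<Longrightarrow> \<phi> v \<noteq> - \<infinity>"
    using S by (auto simp: proper_on_def)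
  show fin: "\<bar>\<phi> z\<bar> \<noteq> \<infinity>"
    using min[OF v0(1)] v0(2) nm[OF v0(1)] nm[OF zS] a
    by (cases "\<phi> z"; cases "\<phi> v0") auto
  assume v: "v \<in> S" "\<phi> v < \<infinity>"
  obtain rz rv where r: "\<phi> z = ereal rz" "\<phi> v = ereal rv"
    using fin nm[OF v(1)] v(2) by (cases "\<phi> z"; cases "\<phi> v") auto
  have ex: "(norm (u - ?c))\<^sup>2 = (norm (u - p))\<^sup>2 + 2 * a * (w \<bullet> (u - p)) + a\<^sup>2 * (norm w)\<^sup>2" for u
  proof -
    have "u - ?c = (u - p) + a *\<^sub>R w" by simp
    then show ?thesis
      by (simp only: power2_norm_eq_inner) (simp add: inner_add_left inner_add_right inner_commute power2_eq_square)
  qed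
  have "a * rz + (norm (z - ?c))\<^sup>2 / 2 \<le> a * rv + (norm (v - ?c))\<^sup>2 / 2"
    using min[OF v(1)] r by simp
  then have "a * (rz + w \<bullet> (z - p) + (norm (z - p))\<^sup>2 / (2 * a))
      \<le> a * (rv + w \<bullet> (v - p) + (norm (v - p))\<^sup>2 / (2 * a))"
    using a unfolding ex by (simp add: distrib_left add_divide_distrib)
  then show "real_of_ereal (\<phi> z) + w \<bullet> (z - p) + (norm (z - p))\<^sup>2 / (2 * a)
      \<le> real_of_ereal (\<phi> v) + w \<bullet> (v - p) + (norm (v - p))\<^sup>2 / (2 * a)"
    using a r by simp
qed

section \<open>Lower semicontinuity, Frechet subgradients and gradients\<close>

lemma lsc_on_sequential:
  fixes \<phi> :: "'a::topological_space \<Rightarrow> ereal"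
  assumes "lsc_on S \<phi>" "z0 \<in> S" "\<And>k. z k \<in> S" "z \<longlonglongrightarrow> z0"
    and le: "\<forall>\<^sub>F k in sequentially. \<phi> (z k) \<le> c k" and c: "c \<longlonglongrightarrow> c0"
  shows "\<phi> z0 \<le> c0"
proof (rule dense_le)
  fix C assume C: "C < \<phi> z0"
  then have "C < Liminf (at z0 within S) \<phi>"
    using assms(1,2) unfolding lsc_on_def by (meson order.strict_trans2)
  then have "\<forall>\<^sub>F z in at z0 within S. C < \<phi> z" by (rule less_LiminfD)
  \<comment> \<open>The punctured filter says nothing at \<open>z0\<close>, which the sequence may
    hit; there the bound is the choice of \<open>C\<close>.\<close>
  then have "\<forall>\<^sub>F z in nhds z0. z \<in> S \<longrightarrow> C < \<phi> z"
    unfolding eventually_at_filter by eventually_elim (use C in auto)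
  then have "\<forall>\<^sub>F k in sequentially. C < \<phi> (z k)"
    using assms(3,4) by (auto simp: filterlim_iff elim: eventually_mono)
  then have "\<forall>\<^sub>F k in sequentially. C \<le> c k"
    using le by eventually_elim auto
  then show "C \<le> c0" using tendsto_lowerbound[OF c] by simp
qed

text \<open>A proximal subgradient is a Frechet subgradient: the quadratic error divided by
  \<open>norm (z - x)\<close> tends to zero.\<close>

lemma frechet_subdiff_quadraticI:
  fixes \<phi> :: "'a::real_inner \<Rightarrow> ereal"
  assumes fin: "\<bar>\<phi> x\<bar> \<noteq> \<infinity>"
    and ev: "\<forall>\<^sub>F z in at x. \<phi> x + ereal (y \<bullet> (z - x)) \<le> \<phi> z + ereal (K * (norm (z - x))\<^sup>2)"
  shows "y \<in> frechet_subdiff \<phi> x"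
proof -
  obtain r where r: "\<phi> x = ereal r" using fin by auto
  have "0 \<le> Liminf (at x) (\<lambda>z. (\<phi> z - \<phi> x - ereal (y \<bullet> (z - x))) / ereal (norm (z - x)))"
  proof (cases "at x = bot")
    case True
    then show ?thesis by simp
  next
    case False
    have lim: "((\<lambda>z. ereal (- K * norm (z - x))) \<longlongrightarrow> ereal (- K * norm (x - x))) (at x)"
      by (intro tendsto_intros)
    have "0 = Liminf (at x) (\<lambda>z. ereal (- K * norm (z - x)))"
      using lim_imp_Liminf[OF False lim] by simp
    also have "\<dots> \<le> Liminf (at x) (\<lambda>z. (\<phi> z - \<phi> x - ereal (y \<bullet> (z - x))) / ereal (norm (z - x)))"
    proof (rule Liminf_mono)
      have "\<forall>\<^sub>F z in at x. z \<noteq> x" by (simp add: eventually_at_filter)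
      with ev show "\<forall>\<^sub>F z in at x. ereal (- K * norm (z - x))
          \<le> (\<phi> z - \<phi> x - ereal (y \<bullet> (z - x))) / ereal (norm (z - x))"
      proof eventually_elim
        case (elim z)
        then have n: "norm (z - x) > 0" by simp
        show ?case
        proof (cases "\<phi> z")
          case (real s)
          have "r + y \<bullet> (z - x) \<le> s + K * (norm (z - x))\<^sup>2" using elim(1) r real by simp
          then have "- K * norm (z - x) \<le> (s - r - y \<bullet> (z - x)) / norm (z - x)"
            using n by (simp add: pos_le_divide_eq power2_eq_square)
          then show ?thesis using r real n by simp
        qed (use r n elim in auto)
      qed
    qed
    finally show ?thesis .
  qed
  then show ?thesis using fin by (auto simp: frechet_subdiff_def effdom_def)
qed

lemma grad_has_derivative:
  fixes h :: "'a::euclidean_space \<Rightarrow> ereal"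
  assumes "(\<lambda>z. real_of_ereal (h z)) differentiable (at x)"
  shows "((\<lambda>z. real_of_ereal (h z)) has_derivative (\<lambda>v. v \<bullet> grad h x)) (at x)"
proof -
  obtain h' where h': "((\<lambda>z. real_of_ereal (h z)) has_derivative h') (at x)"
    using assms by (auto simp: differentiable_def)
  \<comment> \<open>The Riesz representative of the derivative; its uniqueness below is what makes
    the definite description in \<open>grad\<close> denote it.\<close>
  define D where "D = (\<Sum>b\<in>Basis. h' b *\<^sub>R b)"
  have "h' v = v \<bullet> D" for v
  proof -
    have "h' v = h' (\<Sum>b\<in>Basis. (v \<bullet> b) *\<^sub>R b)" by (simp add: euclidean_representation)
    also have "\<dots> = (\<Sum>b\<in>Basis. (v \<bullet> b) * h' b)"
      using has_derivative_linear[OF h'] by (simp add: linear_sum linear_cmul)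
    finally show ?thesis by (simp add: D_def inner_sum_right mult.commute)
  qed
  then have "h' = (\<lambda>v. v \<bullet> D)" by auto
  then have D: "GDERIV (\<lambda>z. real_of_ereal (h z)) x :> D"
    using h' by (simp add: gderiv_def)
  have "GDERIV (\<lambda>z. real_of_ereal (h z)) x :> grad h x"
    unfolding grad_def
  proof (rule theI)
    show "GDERIV (\<lambda>z. real_of_ereal (h z)) x :> D" by (rule D)
  next
    fix E assume "GDERIV (\<lambda>z. real_of_ereal (h z)) x :> E"
    then have "(\<lambda>v. v \<bullet> E) = (\<lambda>v. v \<bullet> D)"
      using D unfolding gderiv_def by (rule has_derivative_unique)
    then show "E = D" by (metis inner_commute vector_eq_rdot)
  qed
  then show ?thesis by (simp add: gderiv_def)
qed

text \<open>One application of the mean value theorem along the segment yields the constant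
  \<open>L\<close>. The sharper \<open>L / 2\<close> would need integration, and the factor is
  absorbed in the later choice of step size.\<close>

lemma first_order_bound_of_lipschitz_gradient:
  fixes \<phi> :: "'a::real_inner \<Rightarrow> real"
  assumes S: "convex S" "u \<in> S" "v \<in> S"
    and der: "\<And>z. z \<in> S \<Longrightarrow> (\<phi> has_derivative (\<lambda>d. d \<bullet> G z)) (at z)"
    and lip: "\<And>z w. z \<in> S \<Longrightarrow> w \<in> S \<Longrightarrow> norm (G z - G w) \<le> L * norm (z - w)"
    and L: "0 \<le> L"
  shows "\<bar>\<phi> v - \<phi> u - G u \<bullet> (v - u)\<bar> \<le> L * (norm (v - u))\<^sup>2"
proof -
  define p where "p t = u + t *\<^sub>R (v - u)" for t :: real
  have pS: "p t \<in> S" if "0 \<le> t" "t \<le> 1" for t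
  proof -
    have "p t = (1 - t) *\<^sub>R u + t *\<^sub>R v" by (simp add: p_def algebra_simps)
    then show ?thesis using S that by (simp add: convexD_alt)
  qed
  have "\<exists>t\<in>{0..1}. \<phi> (p 1) - \<phi> (p 0) = (1 - 0) *\<^sub>R (v - u) \<bullet> G (p t)"
  proof (rule mvt_very_simple[where f = "\<lambda>t. \<phi> (p t)" and f' = "\<lambda>t s. s *\<^sub>R (v - u) \<bullet> G (p t)"])
    fix t :: real assume t: "0 \<le> t" "t \<le> 1"
    have "(p has_derivative (\<lambda>s. s *\<^sub>R (v - u))) (at t within {0..1})"
      unfolding p_def by (auto intro!: derivative_eq_intros)
    then show "((\<lambda>t. \<phi> (p t)) has_derivative (\<lambda>s. s *\<^sub>R (v - u) \<bullet> G (p t))) (at t within {0..1})"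
      using der[OF pS[OF t]] by (rule has_derivative_compose)
  qed simp
  then obtain t where t: "0 \<le> t" "t \<le> 1" and eq: "\<phi> v - \<phi> u = (v - u) \<bullet> G (p t)"
    by (auto simp: p_def)
  have "\<phi> v - \<phi> u - G u \<bullet> (v - u) = (G (p t) - G u) \<bullet> (v - u)"
    by (simp add: eq inner_diff_left inner_diff_right inner_commute)
  also have "\<bar>\<dots>\<bar> \<le> norm (G (p t) - G u) * norm (v - u)" by (rule Cauchy_Schwarz_ineq2)
  also have "\<dots> \<le> (L * norm (p t - u)) * norm (v - u)"
    using lip[OF pS[OF t] S(2)] by (intro mult_right_mono) auto
  also have "norm (p t - u) \<le> norm (v - u)"
    using t by (simp add: p_def mult_left_le_one_le)
  finally show ?thesis using L by (simp add: power2_eq_square mult_left_mono mult_right_mono mult.assoc)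
qed

text \<open>A ball is convex, as the mean value argument requires. The local constant in the
  definition may be any real, so its absolute value is returned.\<close>

lemma loc_lipschitz_differentiable_ball:
  fixes h :: "'a::euclidean_space \<Rightarrow> ereal"
  assumes h: "loc_lipschitz_differentiable_on S h" and S: "open S" "x0 \<in> S"
  obtains \<rho> L where "0 < \<rho>" "0 \<le> L" "ball x0 \<rho> \<subseteq> S"
    "\<And>u v. u \<in> ball x0 \<rho> \<Longrightarrow> v \<in> ball x0 \<rho> \<Longrightarrow> norm (grad h u - grad h v) \<le> L * norm (u - v)"
    "\<And>u v. u \<in> ball x0 \<rho> \<Longrightarrow> v \<in> ball x0 \<rho> \<Longrightarrow>
       \<bar>real_of_ereal (h v) - real_of_ereal (h u) - grad h u \<bullet> (v - u)\<bar> \<le> L * (norm (v - u))\<^sup>2"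
proof -
  obtain U L where U: "open U" "x0 \<in> U"
    and lip: "\<And>u v. u \<in> U \<inter> S \<Longrightarrow> v \<in> U \<inter> S \<Longrightarrow> norm (grad h u - grad h v) \<le> L * norm (u - v)"
    using h S(2) unfolding loc_lipschitz_differentiable_on_def by meson
  obtain \<rho> where \<rho>: "0 < \<rho>" "ball x0 \<rho> \<subseteq> U \<inter> S"
    using U S by (meson IntI open_Int open_contains_ball)
  have lip': "norm (grad h u - grad h v) \<le> \<bar>L\<bar> * norm (u - v)"
    if "u \<in> ball x0 \<rho>" "v \<in> ball x0 \<rho>" for u v
  proof -
    have "norm (grad h u - grad h v) \<le> L * norm (u - v)" using lip that \<rho>(2) by blast
    also have "\<dots> \<le> \<bar>L\<bar> * norm (u - v)" by (simp add: mult_right_mono)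
    finally show ?thesis .
  qed
  have der: "((\<lambda>z. real_of_ereal (h z)) has_derivative (\<lambda>v. v \<bullet> grad h z)) (at z)" if "z \<in> ball x0 \<rho>" for z
    using h that \<rho>(2) by (intro grad_has_derivative) (auto simp: loc_lipschitz_differentiable_on_def)
  show thesis
  proof (rule that[of \<rho> "\<bar>L\<bar>"])
    fix u v assume uv: "u \<in> ball x0 \<rho>" "v \<in> ball x0 \<rho>"
    show "\<bar>real_of_ereal (h v) - real_of_ereal (h u) - grad h u \<bullet> (v - u)\<bar> \<le> \<bar>L\<bar> * (norm (v - u))\<^sup>2"
      by (rule first_order_bound_of_lipschitz_gradient[OF convex_ball uv der lip']) auto
  qed (use \<rho> lip' in auto)
qed

lemma loc_lipschitz_differentiable_continuous:
  fixes h :: "'a::euclidean_space \<Rightarrow> ereal"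
  assumes h: "loc_lipschitz_differentiable_on S h" and S: "open S"
  shows "continuous_on S (\<lambda>z. real_of_ereal (h z))" "continuous_on S (grad h)"
proof -
  have "isCont (\<lambda>z. real_of_ereal (h z)) x0" if "x0 \<in> S" for x0
    using h that by (intro differentiable_imp_continuous_within)
      (auto simp: loc_lipschitz_differentiable_on_def)
  then show "continuous_on S (\<lambda>z. real_of_ereal (h z))"
    by (simp add: continuous_at_imp_continuous_on)
  have "isCont (grad h) x0" if x0: "x0 \<in> S" for x0
  proof -
    obtain \<rho> L where \<rho>: "0 < \<rho>" and
      lip: "\<And>u v. u \<in> ball x0 \<rho> \<Longrightarrow> v \<in> ball x0 \<rho> \<Longrightarrow> norm (grad h u - grad h v) \<le> L * norm (u - v)"
      using loc_lipschitz_differentiable_ball[OF h S x0] by metis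
    have "((\<lambda>z. L * norm (z - x0)) \<longlongrightarrow> L * norm (x0 - x0)) (at x0)"
      by (intro tendsto_intros)
    then have "((\<lambda>z. L * norm (z - x0)) \<longlongrightarrow> 0) (at x0)" by simp
    moreover have "\<forall>\<^sub>F z in at x0. norm (grad h z - grad h x0) \<le> L * norm (z - x0)"
      unfolding eventually_at using \<rho> lip
      by (intro exI[of _ \<rho>]) (auto simp: dist_commute)
    ultimately have "((\<lambda>z. grad h z - grad h x0) \<longlongrightarrow> 0) (at x0)"
      using Lim_null_comparison[of "\<lambda>z. grad h z - grad h x0" "\<lambda>z. L * norm (z - x0)"] by simp
    then show ?thesis unfolding isCont_def using LIM_zero_cancel by blast
  qed
  then show "continuous_on S (grad h)" by (simp add: continuous_at_imp_continuous_on)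
qed

section \<open>Blocks of coordinates\<close>

lemma block_in_block_space [simp]: "block J x \<in> block_space J"
  by (simp add: block_def block_space_def)

lemma block_block_space: "v \<in> block_space J \<Longrightarrow> block J v = v"
  by (auto simp: block_def block_space_def vec_eq_iff)

lemma linear_block: "linear (block J)"
  by (rule linearI) (auto simp: block_def vec_eq_iff)

lemma block_diff: "block J (u - v) = block J u - block J v"
  by (auto simp: block_def vec_eq_iff)

lemma block_inner: "block J u \<bullet> v = u \<bullet> block J v"
  by (auto simp: block_def inner_vec_def intro!: sum.cong)

lemma block_inner_block: "block J u \<bullet> block J v = block J u \<bullet> v"
  by (auto simp: block_def inner_vec_def intro!: sum.cong)

lemma norm_block_le: "norm (block J u) \<le> norm u"
proof -
  have "(norm (block J u))\<^sup>2 = block J u \<bullet> u"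
    by (simp add: power2_norm_eq_inner block_inner_block)
  also have "\<dots> \<le> norm (block J u) * norm u" by (rule norm_cauchy_schwarz)
  finally show ?thesis by (cases "block J u = 0") (auto simp: power2_eq_square)
qed

lemma replace_block_diff: "v \<in> block_space J \<Longrightarrow> replace_block J x v - x = v - block J x"
  by (auto simp: replace_block_def block_def block_space_def vec_eq_iff)

lemma block_replace_block: "v \<in> block_space J \<Longrightarrow> block J (replace_block J x v) = v"
  by (auto simp: replace_block_def block_def block_space_def vec_eq_iff)

lemma block_replace_block_disjoint: "I \<inter> J = {} \<Longrightarrow> block I (replace_block J x v) = block I x"
  by (auto simp: replace_block_def block_def vec_eq_iff)

lemma sum_blocks:
  assumes "block_partition N B"
  shows "(\<Sum>i=1..N. block (B i) v) = v"
proof -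
  have "(\<Sum>i=1..N. block (B i) v) $ j = v $ j" for j
  proof -
    obtain i where i: "i \<in> {1..N}" "j \<in> B i" using assms unfolding block_partition_def by blast
    have "j \<notin> B k" if "k \<in> {1..N} - {i}" for k
      using assms i that unfolding block_partition_def disjoint_family_on_def by blast
    then have "(\<Sum>k\<in>{1..N} - {i}. block (B k) v $ j) = 0"
      by (intro sum.neutral) (simp add: block_def)
    then show ?thesis
      using i(2) unfolding sum_component sum.remove[OF finite_atLeastAtMost i(1)] by (simp add: block_def)
  qed
  then show ?thesis by (simp add: vec_eq_iff)
qed

text \<open>Orthogonality of the blocks; it allows inequalities for the single blocks to be added
  without loss.\<close>

lemma sum_blocks_inner:
  assumes "block_partition N B"
  shows "(\<Sum>i=1..N. block (B i) u \<bullet> block (B i) v) = u \<bullet> v"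
  by (simp only: block_inner_block inner_sum_left[symmetric] sum_blocks[OF assms])

section \<open>Nonmonotone descent\<close>

text \<open>The descent inequality gives a short step only into an index where \<open>q\<close> is close to the limit of the
  window maxima, such as a maximizer of a window.  Every index \<open>s\<close> lies at most \<open>M + 1\<close> positions before
  a maximizer of a later window, so it suffices to go back from the maximizers one position at a time.\<close>

lemma nonmonotone_descent:
  fixes u :: "nat \<Rightarrow> 'a::metric_space" and q :: "nat \<Rightarrow> real" and M :: nat
  defines "W \<equiv> \<lambda>t. Max (q ` {t - M..t})"
  assumes q0: "\<And>t. 0 \<le> q t" and b: "0 < b"
    and desc: "\<And>t. q (Suc t) * (1 + b * (dist (u (Suc t)) (u t))\<^sup>2) \<le> W t"
    and unif: "\<And>e. 0 < e \<Longrightarrow> \<exists>d>0. \<forall>t. dist (u (Suc t)) (u t) < d \<longrightarrow> \<bar>q (Suc t) - q t\<bar> < e"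
    and c: "0 < c" "\<exists>\<^sub>F t in sequentially. c \<le> q t"
  shows "(\<lambda>t. dist (u (Suc t)) (u t)) \<longlonglongrightarrow> 0"
proof -
  have le_W: "q s \<le> W t" if "t - M \<le> s" "s \<le> t" for s t
    unfolding W_def using that by (intro Max_ge) auto
  have q_Suc: "q (Suc t) \<le> W t" for t
  proof -
    have "q (Suc t) * 1 \<le> q (Suc t) * (1 + b * (dist (u (Suc t)) (u t))\<^sup>2)"
      using q0 b by (intro mult_left_mono) auto
    then show ?thesis using desc[of t] by simp
  qed
  have "\<exists>s\<in>{t - M..t}. q s = W t" for t
  proof -
    have "W t \<in> q ` {t - M..t}" unfolding W_def by (intro Max_in) auto
    then show ?thesis by auto
  qed
  then have "\<forall>t. \<exists>s. t - M \<le> s \<and> s \<le> t \<and> q s = W t" by (meson atLeastAtMost_iff)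
  then obtain l where l: "\<And>t. t - M \<le> l t" "\<And>t. l t \<le> t" "\<And>t. q (l t) = W t"
    by metis
  \<comment> \<open>A maximizer of the new window is either the new index, controlled by
    \<open>q_Suc\<close>, or already belongs to the old window.\<close>
  have "W (Suc t) \<le> W t" for t
  proof (cases "l (Suc t) = Suc t")
    case True
    then show ?thesis using q_Suc[of t] l(3)[of "Suc t"] by simp
  next
    case False
    then show ?thesis using l(1)[of "Suc t"] l(2)[of "Suc t"] le_W[of t "l (Suc t)"] l(3)[of "Suc t"] by simp
  qed
  then have dec: "decseq W" by (rule decseq_SucI)
  moreover have W_nonneg: "0 \<le> W t" for t using l(3)[of t] q0[of "l t"] by simp
  ultimately obtain Q where Q: "W \<longlonglongrightarrow> Q" using decseq_convergent by metis
  have "c \<le> Q"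
  proof (rule ccontr)
    assume "\<not> c \<le> Q"
    then have "\<forall>\<^sub>F t in sequentially. W t < c" using order_tendstoD(2)[OF Q] by simp
    then have "\<forall>\<^sub>F t in sequentially. \<not> c \<le> q t"
      by eventually_elim (use le_W in \<open>metis diff_le_self order.refl leD order.trans\<close>)
    then show False using c(2) by (simp add: frequently_def)
  qed
  then have Qpos: "0 < Q" using c(1) by simp
  have shift: "filterlim (\<lambda>t. l t - j) at_top sequentially" for j
    unfolding filterlim_at_top
  proof
    fix Z
    show "\<forall>\<^sub>F t in sequentially. Z \<le> l t - j"
      using eventually_ge_at_top[of "Z + j + M"]
      by eventually_elim (use l(1) in \<open>metis Nat.le_diff_conv2 add_leD2 le_add_diff_inverse2 add_le_imp_le_diff order.trans add.assoc diff_le_mono\<close>)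
  qed
  \<comment> \<open>When \<open>q\<close> at the target index and the window maximum before it both
    tend to \<open>Q\<close>, their ratio tends to 1 and the descent inequality squeezes the step.
    Positivity of \<open>Q\<close> is what permits the division.\<close>
  have dist_from_q: "(\<lambda>t. dist (u (Suc (l t - Suc j))) (u (l t - Suc j))) \<longlonglongrightarrow> 0"
    if lim: "(\<lambda>t. q (l t - j)) \<longlonglongrightarrow> Q" for j
  proof -
    let ?D = "\<lambda>t. dist (u (Suc (l t - Suc j))) (u (l t - Suc j))"
    \<comment> \<open>Truncated subtraction breaks this identity as long as
      \<open>l t \<le> j\<close>, hence only eventually.\<close>
    have ev: "\<forall>\<^sub>F t in sequentially. Suc (l t - Suc j) = l t - j"
      using filterlim_at_top[THEN iffD1, OF shift[of 0], rule_format, of "Suc j"]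
      by eventually_elim auto
    have WQ: "(\<lambda>t. W (l t - Suc j)) \<longlonglongrightarrow> Q"
      by (rule filterlim_compose[OF Q shift])
    have "(\<lambda>t. (W (l t - Suc j) / q (l t - j) - 1) / b) \<longlonglongrightarrow> (Q / Q - 1) / b"
      using Qpos b by (intro tendsto_intros WQ lim) auto
    then have up: "(\<lambda>t. (W (l t - Suc j) / q (l t - j) - 1) / b) \<longlonglongrightarrow> 0"
      using Qpos by simp
    have "\<forall>\<^sub>F t in sequentially. 0 < q (l t - j)"
      using order_tendstoD(1)[OF lim Qpos] .
    then have "\<forall>\<^sub>F t in sequentially. (?D t)\<^sup>2 \<le> (W (l t - Suc j) / q (l t - j) - 1) / b"
      using ev
    proof eventually_elim
      case (elim t)
      then show ?case
        using desc[of "l t - Suc j"] b by (simp add: field_simps)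
    qed
    then have "(\<lambda>t. (?D t)\<^sup>2) \<longlonglongrightarrow> 0"
      by (intro tendsto_sandwich[OF _ _ tendsto_const up]) auto
    then have "(\<lambda>t. sqrt ((?D t)\<^sup>2)) \<longlonglongrightarrow> sqrt 0" by (intro tendsto_intros)
    then show ?thesis by simp
  qed
  have q_lim: "(\<lambda>t. q (l t - j)) \<longlonglongrightarrow> Q" for j
  proof (induction j)
    case 0
    then show ?case using Q l(3) by simp
  next
    case (Suc j)
    \<comment> \<open>The step into index \<open>l t - j\<close> is short by
      \<open>dist_from_q\<close>, so \<open>unif\<close> carries the limit of \<open>q\<close> one
      position further back.\<close>
    have "(\<lambda>t. q (Suc (l t - Suc j)) - q (l t - Suc j)) \<longlonglongrightarrow> 0"
      unfolding tendsto_iff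
    proof (intro allI impI)
      fix e :: real assume "0 < e"
      then obtain d where d: "0 < d" "\<And>t. dist (u (Suc t)) (u t) < d \<Longrightarrow> \<bar>q (Suc t) - q t\<bar> < e"
        using unif by metis
      show "\<forall>\<^sub>F t in sequentially. dist (q (Suc (l t - Suc j)) - q (l t - Suc j)) 0 < e"
        using order_tendstoD(2)[OF dist_from_q[OF Suc.IH] d(1)]
        by eventually_elim (simp add: d(2))
    qed
    moreover have "\<forall>\<^sub>F t in sequentially. q (l t - j) - (q (Suc (l t - Suc j)) - q (l t - Suc j)) = q (l t - Suc j)"
      using filterlim_at_top[THEN iffD1, OF shift[of 0], rule_format, of "Suc j"]
    proof eventually_elim
      case (elim t)
      then have "Suc (l t - Suc j) = l t - j" by auto
      then show ?case by simp
    qed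
    ultimately show ?case
      using Lim_transform_eventually[OF tendsto_diff[OF Suc.IH]] by fastforce
  qed
  show ?thesis
    unfolding tendsto_iff
  proof (intro allI impI)
    fix e :: real assume e: "0 < e"
    have "\<forall>\<^sub>F t in sequentially. \<forall>j\<in>{..M}. dist (u (Suc (l t - Suc j))) (u (l t - Suc j)) < e"
      using order_tendstoD(2)[OF dist_from_q[OF q_lim] e] by (intro eventually_ball_finite) auto
    then obtain T where T: "\<And>t j. T \<le> t \<Longrightarrow> j \<le> M \<Longrightarrow> dist (u (Suc (l t - Suc j))) (u (l t - Suc j)) < e"
      by (auto simp: eventually_sequentially)
    have "dist (u (Suc s)) (u s) < e" if s: "T \<le> s" for s
    proof -
      \<comment> \<open>The window of this index is \<open>{s + 1..s + M + 1}\<close>; its maximizer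
        therefore has an offset of at most \<open>M\<close> from \<open>Suc s\<close>.\<close>
      let ?t = "s + M + 1"
      define j where "j = l ?t - Suc s"
      have "Suc s \<le> l ?t" "l ?t \<le> s + M + 1" using l(1,2)[of ?t] by auto
      then have "j \<le> M" "l ?t - Suc j = s" by (auto simp: j_def)
      then show ?thesis using T[of ?t j] s by simp
    qed
    then show "\<forall>\<^sub>F t in sequentially. dist (dist (u (Suc t)) (u t)) 0 < e"
      by (auto simp: eventually_sequentially)
  qed
qed

section \<open>The fractional program\<close>

locale fractional_program =
  fixes f h :: "real ^ 'n::finite \<Rightarrow> ereal"
    and g :: "real ^ 'n \<Rightarrow> real"
    and N :: nat and B :: "nat \<Rightarrow> 'n set" and fs :: "nat \<Rightarrow> real ^ 'n \<Rightarrow> ereal"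
  assumes f_proper: "proper_on UNIV f" and h_proper: "proper_on UNIV h"
    and blocks: "block_partition N B"
    and f_separable: "\<And>z. f z = (\<Sum>i=1..N. fs i (block (B i) z))"
    and fs_proper: "\<And>i. i \<in> {1..N} \<Longrightarrow> proper_on (block_space (B i)) (fs i)"
    and fs_lsc: "\<And>i. i \<in> {1..N} \<Longrightarrow> lsc_on (block_space (B i)) (fs i)"
    and f_cont: "continuous_on (effdom f) f"
    and fs_bdd_below:
      "\<And>i. i \<in> {1..N} \<Longrightarrow> \<exists>m::real. \<forall>v\<in>block_space (B i). ereal m \<le> fs i v"
    and h_diff: "loc_lipschitz_differentiable_on (Omega g) h"
    and g_convex: "convex_on UNIV g" and g_nonneg: "\<And>z. g z \<ge> 0"
    and zeta_nonneg: "\<And>z. z \<in> effdom f \<Longrightarrow> f z + h z \<ge> 0"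
begin

definition num :: "real ^ 'n \<Rightarrow> real" where
  "num z = real_of_ereal (f z) + real_of_ereal (h z)"

lemma g_cont: "continuous_on S g"
  using convex_on_continuous[OF open_UNIV g_convex] continuous_on_subset by blast

lemma open_Omega: "open (Omega g)"
proof -
  have "Omega g = g -` (- {0})" by (auto simp: Omega_def)
  moreover have "open (- {0 :: real})" by (simp add: open_Compl)
  ultimately show ?thesis using open_vimage[OF _ g_cont] by metis
qed

lemma g_pos: "z \<in> Omega g \<Longrightarrow> 0 < g z"
  using g_nonneg[of z] by (simp add: Omega_def)

lemma f_real: "z \<in> effdom f \<Longrightarrow> f z = ereal (real_of_ereal (f z))"
  using f_proper by (cases "f z") (auto simp: effdom_def proper_on_def)

lemma h_real: "z \<in> Omega g \<Longrightarrow> h z = ereal (real_of_ereal (h z))"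
  using h_diff by (cases "h z") (auto simp: loc_lipschitz_differentiable_on_def)

lemma zeta_real:
  assumes "z \<in> effdom f" "\<bar>h z\<bar> \<noteq> \<infinity>"
  shows "zeta f h z = ereal (num z)" "0 \<le> num z"
proof -
  obtain a b where ab: "f z = ereal a" "h z = ereal b" using f_real[OF assms(1)] assms(2) by auto
  then show "zeta f h z = ereal (num z)" by (simp add: zeta_def num_def)
  show "0 \<le> num z" using zeta_nonneg[OF assms(1)] ab by (simp add: num_def)
qed

lemma h_finite: "z \<in> Omega g \<Longrightarrow> \<bar>h z\<bar> \<noteq> \<infinity>"
  using h_real by (metis abs_ereal.simps(1) ereal.distinct(1) infinity_ereal_def)

lemma F_obj_real:
  assumes "z \<in> effdom f" "z \<in> Omega g"
  shows "F_obj f g h z = ereal (num z / g z)"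
  using assms zeta_real(1)[OF assms(1) h_finite[OF assms(2)]] g_pos[OF assms(2)]
  by (simp add: F_obj_def)

lemma effdom_F_obj: "effdom (F_obj f g h) = effdom f \<inter> Omega g"
  using F_obj_real by (auto simp: effdom_def F_obj_def)

lemma eta_real_pos_Omega: "y \<in> effdom (conj_fun g) \<Longrightarrow> 0 < eta_real g z y \<Longrightarrow> z \<in> Omega g"
  using eta_real_le[of y g z] by (auto simp: Omega_def)

lemma Q_obj_real:
  assumes "z \<in> effdom f" "y \<in> effdom (conj_fun g)" "0 < eta_real g z y"
  shows "Q_obj f g h z y = ereal (num z / eta_real g z y)"
  using assms zeta_real(1)[OF assms(1) h_finite[OF eta_real_pos_Omega[OF assms(2,3)]]]
  by (simp add: Q_obj_def eta_eq_eta_real)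

lemma num_continuous: "continuous_on (effdom f \<inter> Omega g) num"
proof -
  have "continuous_on (effdom f) (real_of_ereal \<circ> f)"
    using f_cont f_real by (subst continuous_on_iff_real[symmetric]) (metis abs_ereal.simps(1) ereal.distinct(1) infinity_ereal_def)+
  then have "continuous_on (effdom f) (\<lambda>z. real_of_ereal (f z))" by (simp add: comp_def)
  then show ?thesis
    unfolding num_def
    by (intro continuous_on_add) (use loc_lipschitz_differentiable_continuous(1)[OF h_diff open_Omega]
        continuous_on_subset in blast)+
qed

lemma fs_not_MInf: "i \<in> {1..N} \<Longrightarrow> v \<in> block_space (B i) \<Longrightarrow> fs i v \<noteq> - \<infinity>"
  using fs_proper by (auto simp: proper_on_def)

lemma effdom_f_iff: "z \<in> effdom f \<longleftrightarrow> (\<forall>i\<in>{1..N}. fs i (block (B i) z) < \<infinity>)"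
proof -
  have "f z = \<infinity> \<longleftrightarrow> (\<exists>i\<in>{1..N}. fs i (block (B i) z) = \<infinity>)"
    unfolding f_separable by (rule sum_Pinfty[THEN trans]) simp
  then show ?thesis by (auto simp: effdom_def less_top top_ereal_def[symmetric])
qed

lemma fs_real:
  assumes "z \<in> effdom f" "i \<in> {1..N}"
  shows "fs i (block (B i) z) = ereal (real_of_ereal (fs i (block (B i) z)))"
  using assms(1) assms(2) fs_not_MInf[OF assms(2), of "block (B i) z"]
  by (cases "fs i (block (B i) z)") (force simp: effdom_f_iff)+

lemma f_sum_real:
  assumes "z \<in> effdom f"
  shows "real_of_ereal (f z) = (\<Sum>i=1..N. real_of_ereal (fs i (block (B i) z)))"
proof -
  have "f z = (\<Sum>i=1..N. ereal (real_of_ereal (fs i (block (B i) z))))"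
    unfolding f_separable by (intro sum.cong refl fs_real[OF assms])
  then show ?thesis by simp
qed

lemma block_replace_other:
  assumes "i \<in> {1..N}" "j \<in> {1..N} - {i}"
  shows "block (B j) (replace_block (B i) z v) = block (B j) z"
  using blocks assms unfolding block_partition_def disjoint_family_on_def
  by (intro block_replace_block_disjoint) blast

lemma replace_block_effdom:
  assumes z: "z \<in> effdom f" and i: "i \<in> {1..N}" and v: "v \<in> block_space (B i)" "fs i v < \<infinity>"
  shows "replace_block (B i) z v \<in> effdom f"
    "real_of_ereal (f (replace_block (B i) z v))
      = real_of_ereal (f z) - real_of_ereal (fs i (block (B i) z)) + real_of_ereal (fs i v)"
proof -
  let ?r = "replace_block (B i) z v"
  show r: "?r \<in> effdom f"
    unfolding effdom_f_iff
  proof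
    fix j assume j: "j \<in> {1..N}"
    show "fs j (block (B j) ?r) < \<infinity>"
      using z j i v block_replace_other[OF i, of j] block_replace_block[OF v(1)]
      by (cases "j = i") (auto simp: effdom_f_iff)
  qed
  have "(\<Sum>j\<in>{1..N} - {i}. real_of_ereal (fs j (block (B j) ?r)))
      = (\<Sum>j\<in>{1..N} - {i}. real_of_ereal (fs j (block (B j) z)))"
    by (intro sum.cong refl) (simp only: block_replace_other[OF i])
  then show "real_of_ereal (f ?r)
      = real_of_ereal (f z) - real_of_ereal (fs i (block (B i) z)) + real_of_ereal (fs i v)"
    unfolding f_sum_real[OF z] f_sum_real[OF r] sum.remove[OF finite_atLeastAtMost i]
      block_replace_block[OF v(1)] by simp
qed

text \<open>On a compact set \<open>f\<close> is bounded above by continuity and the other summands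
  are bounded below, which bounds one summand from above; from below it is bounded everywhere. The
  gap later limits how far a proximal candidate can move.\<close>

lemma block_values_gap:
  assumes S: "compact S" "S \<subseteq> effdom f \<inter> Omega g"
  obtains C where "0 \<le> C"
    "\<And>i z v. i \<in> {1..N} \<Longrightarrow> z \<in> S \<Longrightarrow> v \<in> block_space (B i) \<Longrightarrow> fs i v < \<infinity> \<Longrightarrow>
      real_of_ereal (fs i (block (B i) z)) - real_of_ereal (fs i v) \<le> C"
proof -
  obtain m where m: "\<And>i v. i \<in> {1..N} \<Longrightarrow> v \<in> block_space (B i) \<Longrightarrow> ereal (m i) \<le> fs i v"
    using fs_bdd_below by metis
  have m_real: "m i \<le> real_of_ereal (fs i v)"
    if "i \<in> {1..N}" "v \<in> block_space (B i)" "fs i v < \<infinity>" for i v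
    using m[OF that(1,2)] that(3) by (cases "fs i v") auto
  have "continuous_on S (\<lambda>z. num z - real_of_ereal (h z))"
    using num_continuous loc_lipschitz_differentiable_continuous(1)[OF h_diff open_Omega] S(2)
    by (intro continuous_on_diff) (auto elim: continuous_on_subset)
  then have "bounded ((\<lambda>z. num z - real_of_ereal (h z)) ` S)"
    using S(1) compact_continuous_image compact_imp_bounded by blast
  then obtain A where A: "\<And>z. z \<in> S \<Longrightarrow> \<bar>real_of_ereal (f z)\<bar> \<le> A"
    unfolding bounded_iff num_def by auto
  show thesis
  proof (rule that[of "\<bar>A\<bar> + (\<Sum>i=1..N. \<bar>m i\<bar>)"])
    fix i z v assume i: "i \<in> {1..N}" and z: "z \<in> S" and v: "v \<in> block_space (B i)" "fs i v < \<infinity>"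
    have zf: "z \<in> effdom f" using z S(2) by auto
    have "(\<Sum>j\<in>{1..N} - {i}. m j) \<le> (\<Sum>j\<in>{1..N} - {i}. real_of_ereal (fs j (block (B j) z)))"
      using zf by (intro sum_mono m_real) (auto simp: effdom_f_iff)
    then have "real_of_ereal (fs i (block (B i) z)) + (\<Sum>j\<in>{1..N} - {i}. m j) \<le> real_of_ereal (f z)"
      unfolding f_sum_real[OF zf] sum.remove[OF finite_atLeastAtMost i] by simp
    then have "real_of_ereal (fs i (block (B i) z)) - real_of_ereal (fs i v)
        \<le> A - (\<Sum>j=1..N. m j)"
      using A[OF z] m_real[OF i v] unfolding sum.remove[OF finite_atLeastAtMost i] by linarith
    also have "\<dots> \<le> \<bar>A\<bar> + (\<Sum>j=1..N. \<bar>m j\<bar>)"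
      using sum_abs[of m "{1..N}"] by linarith
    finally show "real_of_ereal (fs i (block (B i) z)) - real_of_ereal (fs i v)
        \<le> \<bar>A\<bar> + (\<Sum>j=1..N. \<bar>m j\<bar>)" .
  qed (simp add: sum_nonneg)
qed

text \<open>The proximal inequality and the quadratic bound on \<open>h\<close> leave
  \<open>num z + q * (y \<bullet> d)\<close> on the right, and this is exactly \<open>q\<close>
  times \<open>\<eta>\<close> at the new point, since \<open>\<eta>\<close> is affine with slope
  \<open>y\<close>.\<close>

lemma line_search_accepts:
  assumes z: "z \<in> effdom f" "z \<in> Omega g" and y: "y \<in> effdom (conj_fun g)" "0 < eta_real g z y"
    and i: "i \<in> {1..N}" and v: "v \<in> block_space (B i)" "fs i v < \<infinity>"
    and q: "q = num z / eta_real g z y" "q \<le> ql"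
    and desc: "real_of_ereal (fs i v) + block (B i) (grad h z - q *\<^sub>R y) \<bullet> (v - block (B i) z)
        + (norm (v - block (B i) z))\<^sup>2 / (2 * a) \<le> real_of_ereal (fs i (block (B i) z))"
    and h': "\<bar>h (replace_block (B i) z v)\<bar> \<noteq> \<infinity>"
      "real_of_ereal (h (replace_block (B i) z v)) \<le> real_of_ereal (h z)
        + grad h z \<bullet> (replace_block (B i) z v - z) + L * (norm (replace_block (B i) z v - z))\<^sup>2"
    and a: "L + \<sigma> / 2 \<le> 1 / (2 * a)" and \<sigma>: "0 < \<sigma>"
  shows "ls_accept f g h \<sigma> (ereal ql) z y (replace_block (B i) z v)"
proof -
  let ?r = "replace_block (B i) z v"
  define d where "d = ?r - z"
  have d: "d = v - block (B i) z" using replace_block_diff[OF v(1)] by (simp add: d_def)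
  have bd: "block (B i) w \<bullet> d = w \<bullet> d" for w
    using block_block_space[OF v(1)] block_block_space[OF block_in_block_space, of "B i" z]
    by (simp add: block_inner d block_diff)
  note r = replace_block_effdom[OF z(1) i v]
  have "(L + \<sigma> / 2) * (norm d)\<^sup>2 \<le> 1 / (2 * a) * (norm d)\<^sup>2"
    using a by (rule mult_right_mono) simp
  moreover have "real_of_ereal (fs i v) + (grad h z \<bullet> d - q * (y \<bullet> d)) + 1 / (2 * a) * (norm d)\<^sup>2
      \<le> real_of_ereal (fs i (block (B i) z))"
    using desc unfolding d[symmetric] bd by (simp add: inner_diff_left)
  moreover have "real_of_ereal (h ?r) \<le> real_of_ereal (h z) + grad h z \<bullet> d + L * (norm d)\<^sup>2"
    using h'(2) by (simp add: d_def)
  ultimately have "num ?r + \<sigma> / 2 * (norm d)\<^sup>2 \<le> num z + q * (y \<bullet> d)"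
    unfolding num_def r(2) by (simp add: distrib_right)
  also have "num z = q * eta_real g z y" using q(1) y(2) by simp
  finally have main: "num ?r + \<sigma> / 2 * (norm d)\<^sup>2 \<le> q * eta_real g ?r y"
    using eta_real_affine[of g ?r y z] by (simp add: d_def distrib_left)
  note num = zeta_real[OF r(1) h'(1)]
  have "0 \<le> q" using zeta_real(2)[OF z(1) h_finite[OF z(2)]] q(1) y(2) by simp
  \<comment> \<open>Replacing \<open>q\<close> by the larger \<open>ql\<close> needs this sign. For
    \<open>q = 0\<close> the inequality \<open>main\<close> only says that the step is zero, and
    \<open>\<eta>\<close> keeps its old positive value.\<close>
  have "0 \<le> eta_real g ?r y"
  proof (cases "q = 0")
    case True
    then have "\<sigma> / 2 * (norm d)\<^sup>2 \<le> 0" using main num(2) by simp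
    then have "d = 0" using \<sigma> by (simp add: mult_le_0_iff)
    then show ?thesis using y(2) by (simp add: d_def)
  next
    case False
    have "0 \<le> \<sigma> / 2 * (norm d)\<^sup>2" using \<sigma> by simp
    then have "0 \<le> q * eta_real g ?r y" using main num(2) by linarith
    then show ?thesis using False \<open>0 \<le> q\<close> by (simp add: zero_le_mult_iff)
  qed
  then have "q * eta_real g ?r y \<le> ql * eta_real g ?r y" using q(2) by (rule mult_right_mono[rotated])
  then show ?thesis
    using main num(1) eta_eq_eta_real[OF y(1), of ?r] unfolding ls_accept_def by (simp add: d_def)
qed

text \<open>The case of the optimal value zero needs no descent argument: a zero of the nonnegative
  function \<open>f + h\<close> minimizes it.\<close>

lemma frechet_subdiff_of_num_zero:
  assumes z: "z \<in> effdom f" "z \<in> Omega g" and "num z = 0"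
  shows "- grad h z \<in> frechet_subdiff f z"
proof -
  obtain \<rho> L where \<rho>: "0 < \<rho>" "ball z \<rho> \<subseteq> Omega g"
    and bound: "\<And>u v. u \<in> ball z \<rho> \<Longrightarrow> v \<in> ball z \<rho> \<Longrightarrow>
       \<bar>real_of_ereal (h v) - real_of_ereal (h u) - grad h u \<bullet> (v - u)\<bar> \<le> L * (norm (v - u))\<^sup>2"
    using loc_lipschitz_differentiable_ball[OF h_diff open_Omega z(2)] by metis
  show ?thesis
  proof (rule frechet_subdiff_quadraticI)
    show "\<bar>f z\<bar> \<noteq> \<infinity>" using f_real[OF z(1)] by (metis abs_ereal.simps(1) ereal.distinct(1) infinity_ereal_def)
    have "f z + ereal (- grad h z \<bullet> (v - z)) \<le> f v + ereal (L * (norm (v - z))\<^sup>2)"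
      if v: "v \<in> ball z \<rho>" for v
    proof (cases "v \<in> effdom f")
      case True
      have "0 \<le> num v" using zeta_real(2)[OF True h_finite] v \<rho>(2) by blast
      then have "real_of_ereal (f z) + - grad h z \<bullet> (v - z) \<le> real_of_ereal (f v) + L * (norm (v - z))\<^sup>2"
        using bound[of z v] v \<rho>(1) assms(3) by (simp add: num_def abs_le_iff)
      then show ?thesis
        by (subst f_real[OF z(1)], subst f_real[OF True]) simp
    qed (simp add: effdom_def)
    then show "\<forall>\<^sub>F v in at z. f z + ereal (- grad h z \<bullet> (v - z)) \<le> f v + ereal (L * (norm (v - z))\<^sup>2)"
      unfolding eventually_at using \<rho>(1) by (intro exI[of _ \<rho>]) (auto simp: dist_commute)
  qed
qed

text \<open>Summing over the blocks gives a global quadratic minorant of \<open>f\<close> at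
  \<open>z\<close> with slope \<open>- w\<close>.\<close>

lemma frechet_subdiff_of_blocks:
  assumes z: "z \<in> effdom f"
    and ineq: "\<And>i v. i \<in> {1..N} \<Longrightarrow> v \<in> block_space (B i) \<Longrightarrow> fs i v < \<infinity> \<Longrightarrow>
      real_of_ereal (fs i (block (B i) z)) \<le> real_of_ereal (fs i v)
        + block (B i) w \<bullet> (v - block (B i) z) + K * (norm (v - block (B i) z))\<^sup>2"
  shows "- w \<in> frechet_subdiff f z"
proof (rule frechet_subdiff_quadraticI)
  show "\<bar>f z\<bar> \<noteq> \<infinity>" using f_real[OF z] by (metis abs_ereal.simps(1) ereal.distinct(1) infinity_ereal_def)
  have "f z + ereal (- w \<bullet> (v - z)) \<le> f v + ereal (K * (norm (v - z))\<^sup>2)" for v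
  proof (cases "v \<in> effdom f")
    case True
    have "real_of_ereal (f z) \<le> (\<Sum>i=1..N. real_of_ereal (fs i (block (B i) v))
        + block (B i) w \<bullet> block (B i) (v - z) + K * (block (B i) (v - z) \<bullet> block (B i) (v - z)))"
      unfolding f_sum_real[OF z]
    proof (rule sum_mono)
      fix i assume i: "i \<in> {1..N}"
      then show "real_of_ereal (fs i (block (B i) z)) \<le> real_of_ereal (fs i (block (B i) v))
        + block (B i) w \<bullet> block (B i) (v - z) + K * (block (B i) (v - z) \<bullet> block (B i) (v - z))"
        using ineq[OF i block_in_block_space, of v] True
        by (simp add: effdom_f_iff block_diff power2_norm_eq_inner)
    qed
    also have "\<dots> = real_of_ereal (f v) + w \<bullet> (v - z) + K * (norm (v - z))\<^sup>2"
      by (simp only: sum.distrib sum_distrib_left[symmetric] sum_blocks_inner[OF blocks]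
          f_sum_real[OF True] power2_norm_eq_inner)
    finally show ?thesis
      by (subst f_real[OF z], subst f_real[OF True]) simp
  qed (simp add: effdom_def)
  then show "\<forall>\<^sub>F v in at z. f z + ereal (- w \<bullet> (v - z)) \<le> f v + ereal (K * (norm (v - z))\<^sup>2)"
    by simp
qed

end

section \<open>Runs of the cyclic algorithm\<close>

locale cmpga_run = fractional_program f h g N B fs
  for f h :: "real ^ 'n::finite \<Rightarrow> ereal" and g N and B :: "nat \<Rightarrow> 'n set" and fs +
  fixes \<alpha>min \<alpha>max \<sigma> \<gamma> gbar :: real and M :: nat and x y :: "nat \<Rightarrow> real ^ 'n"
  assumes \<alpha>_bounds: "0 < \<alpha>min" "\<alpha>min \<le> \<alpha>max"
    and \<sigma>_pos: "\<sigma> > 0" and \<gamma>_bounds: "0 < \<gamma>" "\<gamma> < 1"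
    and generated: "CMPGA N B fs f g h \<alpha>min \<alpha>max \<sigma> \<gamma> M x y"
    and level_compact: "compact (level_set f g h (x 0))"
    and gbar_pos: "gbar > 0" and gbar_bound: "\<And>z. z \<in> level_set f g h (x 0) \<Longrightarrow> g z \<le> gbar"
begin

abbreviation X :: "(real ^ 'n) set" where "X \<equiv> level_set f g h (x 0)"
abbreviation Y :: "(real ^ 'n) set" where "Y \<equiv> dual_set g X gbar \<alpha>min"

text \<open>In the notation of the algorithm, \<open>q t\<close> is \<open>Q_(t)\<close> and \<open>W t\<close> is \<open>Q_(l(t))\<close>.\<close>

definition e :: "nat \<Rightarrow> real" where "e t = eta_real g (x t) (y t)"
definition q :: "nat \<Rightarrow> real" where "q t = num (x t) / e t"
definition W :: "nat \<Rightarrow> real" where "W t = Max (q ` {t - M..t})"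

section \<open>The initial point and the compact primal and dual sets\<close>

lemma start: "x 0 \<in> effdom f" "x 0 \<in> Omega g" "y 0 \<in> convex_subdiff g (x 0)"
  using generated effdom_F_obj by (auto simp: CMPGA_def MPGA_def)

lemma e_0: "e 0 = g (x 0)" by (simp add: e_def eta_real_subdiff start)

lemma F_obj_start: "F_obj f g h (x 0) = ereal (q 0)"
  using F_obj_real[OF start(1,2)] by (simp add: q_def e_0)

lemma X_D: assumes "z \<in> X" shows "z \<in> effdom f" "z \<in> Omega g"
proof -
  have "F_obj f g h z \<le> ereal (q 0)" using assms by (simp add: level_set_def F_obj_start)
  then have "z \<in> effdom (F_obj f g h)" by (auto simp: effdom_def intro: le_less_trans)
  then show "z \<in> effdom f" "z \<in> Omega g" by (auto simp: effdom_F_obj)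
qed

lemma num_nonneg: "z \<in> X \<Longrightarrow> 0 \<le> num z"
  by (rule zeta_real(2)[OF X_D(1) h_finite[OF X_D(2)]])

text \<open>Since \<open>\<eta>\<close> is at most \<open>g\<close> and the numerator is
  nonnegative, \<open>F\<close> is at most \<open>Q\<close>; at the starting point the two
  agree.\<close>

lemma X_I:
  assumes "z \<in> effdom f" "v \<in> effdom (conj_fun g)" "0 < eta_real g z v"
    and "num z / eta_real g z v \<le> q 0"
  shows "z \<in> X"
proof -
  have \<Omega>: "z \<in> Omega g" using eta_real_pos_Omega assms by blast
  have "num z / g z \<le> num z / eta_real g z v"
    using zeta_real(2)[OF assms(1) h_finite[OF \<Omega>]] eta_real_le[OF assms(2), of z] assms(3)
    by (intro divide_left_mono) auto
  then show ?thesis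
    using assms(4) by (simp add: level_set_def F_obj_start F_obj_real[OF assms(1) \<Omega>])
qed

lemma x_0_in_X: "x 0 \<in> X" by (simp add: level_set_def)

lemma compact_enlarged: "compact (enlarged_set X gbar \<alpha>min)"
proof -
  have "enlarged_set X gbar \<alpha>min = {z. infdist z X \<le> sqrt (gbar / \<alpha>min)}"
    using infdist_nonneg[of _ X] by (auto simp: enlarged_set_def real_le_rsqrt sqrt_ge_absD real_le_lsqrt)
  moreover have "0 < sqrt (gbar / \<alpha>min)" using gbar_pos \<alpha>_bounds by simp
  ultimately show ?thesis
    using compact_infdist_le[OF _ level_compact] x_0_in_X by (metis empty_iff)
qed

lemma compact_Y: "compact Y"
  unfolding dual_set_def by (rule compact_convex_subdiff_image[OF g_convex compact_enlarged])

lemma Y_effdom: "v \<in> Y \<Longrightarrow> v \<in> effdom (conj_fun g)"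
  by (auto simp: dual_set_def intro: convex_subdiff_effdom)

lemma X_subset_enlarged: "z \<in> X \<Longrightarrow> z \<in> enlarged_set X gbar \<alpha>min"
  using gbar_pos \<alpha>_bounds by (simp add: enlarged_set_def)

lemma subdiff_X_Y: "z \<in> X \<Longrightarrow> v \<in> convex_subdiff g z \<Longrightarrow> v \<in> Y"
  using X_subset_enlarged by (auto simp: dual_set_def)

section \<open>Invariance of the compact sets along the run\<close>

lemma step:
  "if t mod (N + 1) = 0 then step_Y g \<alpha>min \<alpha>max (x t) (y t) (x (Suc t)) (y (Suc t))
   else step_X (B (t mod (N + 1))) (fs (t mod (N + 1))) f g h \<alpha>min \<alpha>max \<sigma> \<gamma> (Q_obj f g h (x t) (y t))
     (Q_obj f g h (x (ls_index (\<lambda>s. Q_obj f g h (x s) (y s)) M t))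
       (y (ls_index (\<lambda>s. Q_obj f g h (x s) (y s)) M t)))
     (x t) (y t) (x (Suc t)) (y (Suc t))"
  using generated by (simp add: CMPGA_def MPGA_def Let_def)

text \<open>The proximal step read as an implicit subgradient step: the base point is
  \<open>x t\<close> displaced by the scaled dual step, and returns to \<open>x t\<close> as that
  step shrinks.\<close>

lemma dual_step:
  assumes "t mod (N + 1) = 0"
  shows "x (Suc t) = x t"
    "\<exists>\<alpha>\<in>{\<alpha>min..\<alpha>max}. y (Suc t) \<in> convex_subdiff g (x t + (y t - y (Suc t)) /\<^sub>R \<alpha>)"
proof -
  have "step_Y g \<alpha>min \<alpha>max (x t) (y t) (x (Suc t)) (y (Suc t))" using step[of t] assms by simp
  then obtain \<alpha> where x: "x (Suc t) = x t" and \<alpha>: "\<alpha> \<in> {\<alpha>min..\<alpha>max}"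
    and prox: "y (Suc t) \<in> prox (\<lambda>v. ereal \<alpha> * conj_fun g v) (y t + \<alpha> *\<^sub>R x t)"
    by (auto simp: step_Y_def)
  show "x (Suc t) = x t" by (rule x)
  have "0 < \<alpha>" using \<alpha> \<alpha>_bounds by auto
  then have "y (Suc t) \<in> convex_subdiff g ((y t + \<alpha> *\<^sub>R x t - y (Suc t)) /\<^sub>R \<alpha>)"
    using prox_conj_subdiff[OF g_convex _ prox] by blast
  moreover have "(y t + \<alpha> *\<^sub>R x t - y (Suc t)) /\<^sub>R \<alpha> = x t + (y t - y (Suc t)) /\<^sub>R \<alpha>"
    using \<open>0 < \<alpha>\<close> by (simp add: algebra_simps)
  ultimately show "\<exists>\<alpha>\<in>{\<alpha>min..\<alpha>max}. y (Suc t) \<in> convex_subdiff g (x t + (y t - y (Suc t)) /\<^sub>R \<alpha>)"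
    using \<alpha> by auto
qed

text \<open>The induction invariant. The bound by \<open>q 0\<close> belongs to it because the
  window gives no decrease from one index to the next.\<close>

definition admissible :: "nat \<Rightarrow> bool" where
  "admissible t \<longleftrightarrow> x t \<in> X \<and> y t \<in> Y \<and> 0 < e t \<and> q t \<le> q 0"

lemma admissible_Q: "admissible t \<Longrightarrow> Q_obj f g h (x t) (y t) = ereal (q t)"
  using Q_obj_real[of "x t" "y t"] X_D Y_effdom by (simp add: admissible_def q_def e_def)

lemma admissible_q_nonneg: "admissible t \<Longrightarrow> 0 \<le> q t"
  using num_nonneg by (simp add: admissible_def q_def)

text \<open>Admissibility makes all values in the window finite, and the monotone map
  \<open>ereal\<close> commutes with finite maxima, so the reference value of the line search is the
  real number \<open>W t\<close>.\<close>

lemma window_Q: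
  assumes "\<And>s. s \<le> t \<Longrightarrow> admissible s"
  shows "Q_obj f g h (x (ls_index (\<lambda>s. Q_obj f g h (x s) (y s)) M t))
       (y (ls_index (\<lambda>s. Q_obj f g h (x s) (y s)) M t)) = ereal (W t)"
    "0 \<le> W t" "W t \<le> q 0" "q t \<le> W t"
proof -
  let ?Q = "\<lambda>s. Q_obj f g h (x s) (y s)"
  let ?J = "{j. j \<le> t \<and> ?Q j = Max (?Q ` {t - M..t})}"
  have "Max (?Q ` {t - M..t}) \<in> ?Q ` {t - M..t}" by (intro Max_in) auto
  then obtain s where "s \<in> {t - M..t}" "Max (?Q ` {t - M..t}) = ?Q s" by (rule imageE)
  then have "s \<in> ?J" by simp
  then have "?J \<noteq> {}" by blast
  then have "ls_index ?Q M t \<in> ?J" unfolding ls_index_def by (intro Max_in) auto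
  moreover have "?Q ` {t - M..t} = ereal ` q ` {t - M..t}"
    unfolding image_image by (intro image_cong refl admissible_Q assms) simp
  moreover have "ereal (W t) = Max (ereal ` q ` {t - M..t})"
    unfolding W_def by (intro mono_Max_commute) (auto simp: mono_def)
  ultimately show "?Q (ls_index ?Q M t) = ereal (W t)" by simp
  show "q t \<le> W t" unfolding W_def by (intro Max_ge) auto
  then show "0 \<le> W t" using admissible_q_nonneg[OF assms] by (meson order.refl order.trans)
  show "W t \<le> q 0" unfolding W_def using assms by (intro Max.boundedI) (auto simp: admissible_def)
qed

lemma admissible_dual_step:
  assumes t: "t mod (N + 1) = 0" and admissible: "admissible t"
  shows "admissible (Suc t)"
proof -
  obtain \<alpha> where \<alpha>: "\<alpha>min \<le> \<alpha>" and y': "y (Suc t) \<in> convex_subdiff g (x t + (y t - y (Suc t)) /\<^sub>R \<alpha>)"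
    using dual_step(2)[OF t] by auto
  have \<alpha>0: "0 < \<alpha>" using \<alpha> \<alpha>_bounds by simp
  have yt: "y t \<in> effdom (conj_fun g)" using admissible Y_effdom by (simp add: admissible_def)
  have e': "e t + (norm (y (Suc t) - y t))\<^sup>2 / \<alpha> \<le> e (Suc t)"
    using eta_real_dual_step[OF \<alpha>0 y' yt] by (simp add: e_def dual_step(1)[OF t])
  have ee: "e t \<le> e (Suc t)" using e' \<alpha>0 by (smt (verit) divide_nonneg_pos zero_le_power2)
  have "e (Suc t) \<le> gbar"
    using eta_real_le[OF convex_subdiff_effdom[OF y'], of "x t"] gbar_bound[of "x t"] admissible
    by (simp add: e_def dual_step(1)[OF t] admissible_def)
  then have "(norm (y (Suc t) - y t))\<^sup>2 / \<alpha> \<le> gbar" using e' admissible by (simp add: admissible_def)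
  \<comment> \<open>The origin of the radius in \<open>enlarged_set\<close>: the gain of a dual step
    is at most \<open>gbar\<close>, and a second division by \<open>\<alpha>\<close> turns it into
    the squared distance from \<open>x t\<close> to the base point of the new subgradient.\<close>
  then have "(norm (y (Suc t) - y t))\<^sup>2 / \<alpha> / \<alpha> \<le> gbar / \<alpha>min"
    using \<alpha> \<alpha>_bounds gbar_pos by (intro frac_le) auto
  moreover have "dist (x t + (y t - y (Suc t)) /\<^sub>R \<alpha>) (x t) = norm (y (Suc t) - y t) / \<alpha>"
    using \<alpha>0 by (simp add: dist_norm norm_minus_commute divide_inverse mult.commute)
  ultimately have "(dist (x t + (y t - y (Suc t)) /\<^sub>R \<alpha>) (x t))\<^sup>2 \<le> gbar / \<alpha>min"
    by (simp add: power2_eq_square)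
  moreover have "infdist (x t + (y t - y (Suc t)) /\<^sub>R \<alpha>) X \<le> dist (x t + (y t - y (Suc t)) /\<^sub>R \<alpha>) (x t)"
    using admissible by (intro infdist_le) (simp add: admissible_def)
  ultimately have "x t + (y t - y (Suc t)) /\<^sub>R \<alpha> \<in> enlarged_set X gbar \<alpha>min"
    unfolding enlarged_set_def using infdist_nonneg by (smt (verit) mem_Collect_eq power_mono)
  then have "y (Suc t) \<in> Y" using y' by (auto simp: dual_set_def)
  moreover have "q (Suc t) \<le> q t"
    using ee admissible num_nonneg[of "x t"] unfolding q_def dual_step(1)[OF t] admissible_def
    by (intro divide_left_mono) auto
  ultimately show ?thesis using admissible ee by (simp add: admissible_def dual_step(1)[OF t])
qed

lemma primal_step:
  assumes t: "t mod (N + 1) \<noteq> 0" and admissible: "\<And>s. s \<le> t \<Longrightarrow> admissible s"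
  shows "y (Suc t) = y t"
    and "num (x (Suc t)) + \<sigma> / 2 * (norm (x (Suc t) - x t))\<^sup>2 \<le> W t * e (Suc t)"
    and "admissible (Suc t)"
proof -
  have "step_X (B (t mod (N + 1))) (fs (t mod (N + 1))) f g h \<alpha>min \<alpha>max \<sigma> \<gamma> (Q_obj f g h (x t) (y t))
     (ereal (W t)) (x t) (y t) (x (Suc t)) (y (Suc t))"
    using step[of t] t window_Q(1)[OF admissible] by simp
  then have y': "y (Suc t) = y t" and acc: "ls_accept f g h \<sigma> (ereal (W t)) (x t) (y t) (x (Suc t))"
    by (auto simp: step_X_def)
  show "y (Suc t) = y t" by (rule y')
  have yt: "y t \<in> Y" "0 < e t" "x t \<in> X" "y t \<in> effdom (conj_fun g)"
    using admissible[of t] Y_effdom by (auto simp: admissible_def)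
  have "zeta f h (x (Suc t)) + ereal (\<sigma> / 2 * (norm (x (Suc t) - x t))\<^sup>2) \<le> ereal (W t * e (Suc t))"
    using acc eta_eq_eta_real[OF yt(4)] by (simp add: ls_accept_def e_def y')
  \<comment> \<open>The accepted point is not yet known to lie in \<open>Omega g\<close>, so
    finiteness of \<open>h\<close> there is drawn from properness and the finite right-hand side of
    the test.\<close>
  moreover have "f (x (Suc t)) \<noteq> - \<infinity>" "h (x (Suc t)) \<noteq> - \<infinity>"
    using f_proper h_proper by (auto simp: proper_on_def)
  ultimately have fin: "x (Suc t) \<in> effdom f" "\<bar>h (x (Suc t))\<bar> \<noteq> \<infinity>"
    by (cases "f (x (Suc t))"; cases "h (x (Suc t))"; auto simp: zeta_def effdom_def)+
  note num = zeta_real[OF fin]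
  have win: "0 \<le> W t" "W t \<le> q 0" using window_Q(2,3)[of t] admissible by auto
  show *: "num (x (Suc t)) + \<sigma> / 2 * (norm (x (Suc t) - x t))\<^sup>2 \<le> W t * e (Suc t)"
    using acc eta_eq_eta_real[OF yt(4)] num(1) by (simp add: ls_accept_def e_def y')
  \<comment> \<open>A nonpositive \<open>\<eta>\<close> would make the right-hand side of the test
    nonpositive and force a zero step, which leaves \<open>\<eta>\<close> at its old positive
    value.\<close>
  have e': "0 < e (Suc t)"
  proof (rule ccontr)
    assume "\<not> 0 < e (Suc t)"
    then have "W t * e (Suc t) \<le> 0" using win(1) by (simp add: mult_nonneg_nonpos)
    then have "\<sigma> / 2 * (norm (x (Suc t) - x t))\<^sup>2 \<le> 0" using * num(2) by linarith
    then have "x (Suc t) = x t" using \<sigma>_pos by (simp add: mult_le_0_iff)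
    then show False using \<open>\<not> 0 < e (Suc t)\<close> yt(2) by (simp add: e_def y')
  qed
  have "0 \<le> \<sigma> / 2 * (norm (x (Suc t) - x t))\<^sup>2" using \<sigma>_pos by simp
  then have "num (x (Suc t)) \<le> W t * e (Suc t)" using * by linarith
  then have "q (Suc t) \<le> W t" using e' by (simp add: q_def pos_divide_le_eq)
  then have q': "q (Suc t) \<le> q 0" using win(2) by simp
  then have "x (Suc t) \<in> X"
    using X_I[OF fin(1) yt(4)] e' by (simp add: e_def q_def y')
  then show "admissible (Suc t)" using e' q' yt by (simp add: admissible_def y')
qed

lemma admissible: "admissible t"
proof -
  \<comment> \<open>All earlier indices are carried along because the line search looks back over a
    window.\<close>
  have "\<forall>s\<le>t. admissible s"
  proof (induction t)
    case 0
    then show ?case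
      using start x_0_in_X subdiff_X_Y g_pos by (simp add: admissible_def e_0)
  next
    case (Suc t)
    then have "admissible (Suc t)"
      using admissible_dual_step[of t] primal_step(3)[of t] by (cases "t mod (N + 1) = 0") auto
    then show ?case using Suc by (auto simp: le_Suc_eq)
  qed
  then show ?thesis by simp
qed

lemma iterates: "x t \<in> X" "y t \<in> Y" "0 < e t" "y t \<in> effdom (conj_fun g)" "x t \<in> effdom f" "x t \<in> Omega g"
  using admissible[of t] Y_effdom X_D by (auto simp: admissible_def)

lemmas window = window_Q[OF admissible]
lemmas primal = primal_step(1,2)[OF _ admissible]

lemma q_nonneg: "0 \<le> q t" using admissible_q_nonneg admissible by blast

section \<open>Two-sided bounds on the denominator and vanishing steps\<close>

lemma e_le_gbar: "e t \<le> gbar"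
  using eta_real_le[OF iterates(4)[of t], of "x t"] gbar_bound[OF iterates(1)[of t]] by (simp add: e_def)

lemma dual_e:
  assumes t: "t mod (N + 1) = 0"
  shows "e t + (norm (y (Suc t) - y t))\<^sup>2 / \<alpha>max \<le> e (Suc t)"
proof -
  obtain \<alpha> where \<alpha>: "\<alpha>min \<le> \<alpha>" "\<alpha> \<le> \<alpha>max"
    and y': "y (Suc t) \<in> convex_subdiff g (x t + (y t - y (Suc t)) /\<^sub>R \<alpha>)"
    using dual_step(2)[OF t] by auto
  have "(norm (y (Suc t) - y t))\<^sup>2 / \<alpha>max \<le> (norm (y (Suc t) - y t))\<^sup>2 / \<alpha>"
    using \<alpha> \<alpha>_bounds by (intro divide_left_mono) auto
  moreover have "0 < \<alpha>" using \<alpha> \<alpha>_bounds by simp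
  ultimately show ?thesis
    using eta_real_dual_step[OF _ y' iterates(4)] by (fastforce simp: e_def dual_step(1)[OF t])
qed

lemma e_lower_bound: "\<exists>c>0. \<forall>t. c \<le> e t"
proof -
  obtain D where D: "0 < D" "\<And>v. v \<in> Y \<Longrightarrow> norm v \<le> D"
    using compact_imp_bounded[OF compact_Y] by (auto simp: bounded_pos)
  obtain z0 where z0: "z0 \<in> X" "\<And>z. z \<in> X \<Longrightarrow> g z0 \<le> g z"
    using continuous_attains_inf[OF level_compact _ g_cont] x_0_in_X by blast
  have gm: "0 < g z0" using g_pos X_D z0(1) by blast
  have dual: "min (g z0 / 2) (\<alpha>min * (g z0 / (4 * D))\<^sup>2) \<le> e (Suc t)" if t: "t mod (N + 1) = 0" for t
  proof -
    obtain p where p: "p \<in> convex_subdiff g (x t)" using convex_subdiff_nonempty[OF g_convex] by blast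
    obtain \<alpha> where \<alpha>: "\<alpha>min \<le> \<alpha>" and y': "y (Suc t) \<in> convex_subdiff g (x t + (y t - y (Suc t)) /\<^sub>R \<alpha>)"
      using dual_step(2)[OF t] by auto
    show ?thesis
      using eta_real_dual_step_lower[OF \<alpha>_bounds(1) \<alpha> y' iterates(4) _ p D(1) _ _ gm]
        iterates(3)[of t] D(2)[OF subdiff_X_Y[OF iterates(1) p]] D(2)[OF iterates(2)] z0(2)[OF iterates(1)]
      by (simp add: e_def dual_step(1)[OF t])
  qed
  \<comment> \<open>A step of length at most \<open>c / (2 * D)\<close> changes
    \<open>\<eta>\<close> by at most \<open>c / 2\<close>. A longer one makes the left side of the
    acceptance test large, and \<open>W t\<close> is at most \<open>q 0\<close>; the added 1 avoids
    division by zero when \<open>q 0 = 0\<close>.\<close>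
  have primal_c: "min (c / 2) (\<sigma> * (c / (2 * D))\<^sup>2 / (2 * (q 0 + 1))) \<le> e (Suc t)"
    if t: "t mod (N + 1) \<noteq> 0" and c: "0 < c" "c \<le> e t" for t c
  proof (cases "norm (x (Suc t) - x t) \<le> c / (2 * D)")
    case True
    have "e (Suc t) = e t + y t \<bullet> (x (Suc t) - x t)"
      using eta_real_affine[of g "x (Suc t)" "y t" "x t"] by (simp add: e_def primal(1)[OF t])
    moreover have "\<bar>y t \<bullet> (x (Suc t) - x t)\<bar> \<le> D * norm (x (Suc t) - x t)"
      by (rule order.trans[OF Cauchy_Schwarz_ineq2 mult_right_mono[OF D(2)[OF iterates(2)] norm_ge_zero]])
    moreover have "D * norm (x (Suc t) - x t) \<le> c / 2" using True D(1) by (simp add: field_simps)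
    ultimately have "c / 2 \<le> e (Suc t)" using c(2) by linarith
    then show ?thesis by simp
  next
    case False
    have "\<sigma> / 2 * (c / (2 * D))\<^sup>2 \<le> \<sigma> / 2 * (norm (x (Suc t) - x t))\<^sup>2"
      using False \<sigma>_pos c D(1) by (intro mult_left_mono power_mono) auto
    also have "\<dots> \<le> W t * e (Suc t)"
      using primal(2)[OF t] num_nonneg[OF iterates(1), of "Suc t"] by linarith
    also have "\<dots> \<le> (q 0 + 1) * e (Suc t)"
      using window(3)[of t] iterates(3)[of "Suc t"] by (intro mult_right_mono) auto
    finally have "\<sigma> * (c / (2 * D))\<^sup>2 \<le> e (Suc t) * (2 * (q 0 + 1))"
      by (simp only: mult.commute[of "e (Suc t)"])
    then have "\<sigma> * (c / (2 * D))\<^sup>2 / (2 * (q 0 + 1)) \<le> e (Suc t)"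
      using q_nonneg[of 0] by (subst pos_divide_le_eq) auto
    then show ?thesis by simp
  qed
  \<comment> \<open>Induction on the phase within a cycle. The dual phase yields a constant that
    does not depend on the past, so the losses of the primal phases do not accumulate from cycle to
    cycle.\<close>
  have "\<exists>c>0. \<forall>t. t mod (N + 1) \<le> j \<longrightarrow> c \<le> e (Suc t)" for j
  proof (induction j)
    case 0
    have "0 < min (g z0 / 2) (\<alpha>min * (g z0 / (4 * D))\<^sup>2)" using gm \<alpha>_bounds D(1) by simp
    then show ?case using dual by (metis le_zero_eq)
  next
    case (Suc j)
    then obtain c where c: "0 < c" "\<And>t. t mod (N + 1) \<le> j \<Longrightarrow> c \<le> e (Suc t)" by auto
    define c' where "c' = min (c / 2) (\<sigma> * (c / (2 * D))\<^sup>2 / (2 * (q 0 + 1)))"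
    have "0 < c'" using c(1) \<sigma>_pos D(1) q_nonneg[of 0] by (simp add: c'_def)
    moreover have "min c c' \<le> e (Suc t)" if t: "t mod (N + 1) \<le> Suc j" for t
    proof (cases "t mod (N + 1) = Suc j")
      case False
      then show ?thesis using c(2)[of t] t by simp
    next
      case True
      then obtain s where s: "t = Suc s" by (cases t) auto
      have "s mod (N + 1) \<le> j" using True unfolding s by (simp add: mod_Suc split: if_splits)
      then have "c \<le> e t" using c(2) s by blast
      then show ?thesis using primal_c[of t c] True c(1) by (simp add: c'_def)
    qed
    ultimately show ?case using c(1) by (intro exI[of _ "min c c'"]) auto
  qed
  from this[of N] obtain c where c: "0 < c" "\<And>t. c \<le> e (Suc t)"
    by (metis Suc_eq_plus1 less_Suc_eq_le mod_less_divisor zero_less_Suc)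
  \<comment> \<open>The bounds so far concern successors only; index 0 is added by hand.\<close>
  have "min c (e 0) \<le> e t" for t using c(2) by (cases t) (auto simp: min.coboundedI1)
  then show ?thesis using c(1) iterates(3)[of 0] by (intro exI[of _ "min c (e 0)"]) auto
qed

text \<open>In a dual step the denominator grows from \<open>e t\<close> by the squared step over
  \<open>\<alpha>max\<close>, with \<open>e t \<le> gbar\<close>. In a primal step the test divided
  by \<open>e (Suc t)\<close> has an additive gain; bounding \<open>q (Suc t)\<close> by
  \<open>q 0 + 1\<close> casts it in the same multiplicative form. The two arguments of the minimum
  are these two constants.\<close>

lemma sufficient_descent:
  defines "b \<equiv> min (1 / (\<alpha>max * gbar)) (\<sigma> / (2 * gbar * (q 0 + 1)))"
  shows "0 < b" "q (Suc t) * (1 + b * (dist (x (Suc t), y (Suc t)) (x t, y t))\<^sup>2) \<le> W t"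
proof -
  have am: "0 < \<alpha>max" using \<alpha>_bounds by simp
  show "0 < b" using am gbar_pos \<sigma>_pos q_nonneg[of 0] by (simp add: b_def)
  show "q (Suc t) * (1 + b * (dist (x (Suc t), y (Suc t)) (x t, y t))\<^sup>2) \<le> W t"
  proof (cases "t mod (N + 1) = 0")
    case True
    let ?d = "(norm (y (Suc t) - y t))\<^sup>2"
    have d: "(dist (x (Suc t), y (Suc t)) (x t, y t))\<^sup>2 = ?d"
      by (simp add: dist_Pair_Pair dual_step(1)[OF True] dist_norm)
    have "b * ?d \<le> 1 / (\<alpha>max * gbar) * ?d" by (intro mult_right_mono) (auto simp: b_def)
    also have "\<dots> \<le> 1 / (\<alpha>max * e t) * ?d"
      using e_le_gbar[of t] iterates(3)[of t] am gbar_pos by (intro mult_right_mono divide_left_mono) auto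
    finally have "q (Suc t) * (1 + b * ?d) \<le> q (Suc t) * (1 + 1 / (\<alpha>max * e t) * ?d)"
      using q_nonneg by (intro mult_left_mono) auto
    also have "\<dots> = q (Suc t) * (e t + ?d / \<alpha>max) / e t"
      using iterates(3)[of t] am by (simp add: field_simps)
    also have "\<dots> \<le> q (Suc t) * e (Suc t) / e t"
      using dual_e[OF True] q_nonneg iterates(3)[of t] by (intro divide_right_mono mult_left_mono) auto
    also have "\<dots> = q t"
      using iterates(3)[of "Suc t"] by (simp add: q_def dual_step(1)[OF True])
    finally show ?thesis using window(4)[of t] d by simp
  next
    case False
    let ?d = "(norm (x (Suc t) - x t))\<^sup>2"
    have d: "(dist (x (Suc t), y (Suc t)) (x t, y t))\<^sup>2 = ?d"
      by (simp add: dist_Pair_Pair primal(1)[OF False] dist_norm)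
    have cancel: "r * (\<sigma> / (2 * gbar * r) * ?d) = \<sigma> / 2 * ?d / gbar" if "0 < r" for r
      using that gbar_pos by (simp add: field_simps)
    have "q (Suc t) * (b * ?d) \<le> (q 0 + 1) * (b * ?d)"
      using admissible[of "Suc t"] \<open>0 < b\<close> by (intro mult_right_mono) (auto simp: admissible_def)
    also have "\<dots> \<le> (q 0 + 1) * (\<sigma> / (2 * gbar * (q 0 + 1)) * ?d)"
      using q_nonneg[of 0] by (intro mult_left_mono mult_right_mono) (auto simp: b_def)
    also have "\<dots> = \<sigma> / 2 * ?d / gbar"
      using cancel[of "q 0 + 1"] q_nonneg[of 0] by simp
    also have "\<dots> \<le> \<sigma> / 2 * ?d / e (Suc t)"
      using e_le_gbar[of "Suc t"] iterates(3)[of "Suc t"] \<sigma>_pos gbar_pos by (intro divide_left_mono) auto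
    finally have "q (Suc t) * (1 + b * ?d) \<le> (num (x (Suc t)) + \<sigma> / 2 * ?d) / e (Suc t)"
      by (simp add: q_def add_divide_distrib distrib_left)
    also have "\<dots> \<le> W t"
      using primal(2)[OF False] iterates(3)[of "Suc t"] by (simp add: pos_divide_le_eq)
    finally show ?thesis using d by simp
  qed
qed

text \<open>A conjugate is in general only lower semicontinuous. On \<open>Y\<close> it is Lipschitz
  because its subgradients can be chosen in the compact enlarged set.\<close>

lemma conj_real_continuous: "continuous_on Y (conj_real g)"
proof -
  obtain R where R: "0 < R" "\<And>z. z \<in> enlarged_set X gbar \<alpha>min \<Longrightarrow> norm z \<le> R"
    using compact_imp_bounded[OF compact_enlarged] by (auto simp: bounded_pos)
  have "R-lipschitz_on Y (conj_real g)"
  proof (rule lipschitz_onI)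
    fix v w assume "v \<in> Y" "w \<in> Y"
    then show "dist (conj_real g v) (conj_real g w) \<le> R * dist v w"
      using conj_real_lipschitz R(2) unfolding dual_set_def dist_norm by fastforce
  qed (use R in simp)
  then show ?thesis by (rule lipschitz_on_continuous_on)
qed

lemma eta_real_continuous: "continuous_on (X \<times> Y) (\<lambda>(z, v). eta_real g z v)"
  unfolding eta_real_def case_prod_beta
  by (intro continuous_intros continuous_on_compose2[OF conj_real_continuous]) auto

lemma num_continuous_X: "continuous_on X num"
  using num_continuous X_D by (auto elim: continuous_on_subset)

lemma steps_vanish:
  assumes c: "0 < c" "\<exists>\<^sub>F t in sequentially. c \<le> q t"
  shows "(\<lambda>t. dist (x (Suc t), y (Suc t)) (x t, y t)) \<longlonglongrightarrow> 0"
proof -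
  have unif: "\<exists>d>0. \<forall>t. dist (x (Suc t), y (Suc t)) (x t, y t) < d \<longrightarrow> \<bar>q (Suc t) - q t\<bar> < \<epsilon>"
    if \<epsilon>: "0 < \<epsilon>" for \<epsilon>
  proof -
    obtain c where c: "0 < c" "\<And>t. c \<le> e t" using e_lower_bound by blast
    \<comment> \<open>A compact set containing all iterates on which the denominator is at least
      \<open>c\<close>, so that the quotient is uniformly continuous there.\<close>
    define K where "K = (X \<times> Y) \<inter> (\<lambda>(z, v). eta_real g z v) -` {c..}"
    have "compact (X \<times> Y)" by (intro compact_Times level_compact compact_Y)
    moreover from this have "closed K" unfolding K_def
      by (intro continuous_closed_preimage eta_real_continuous compact_imp_closed closed_atLeast)
    moreover have "K \<subseteq> X \<times> Y" by (auto simp: K_def)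
    ultimately have "compact K" by (metis compact_Int_closed inf.absorb2)
    moreover have "continuous_on K (\<lambda>(z, v). num z / eta_real g z v)"
      unfolding case_prod_beta
    proof (intro continuous_on_divide)
      show "continuous_on K (\<lambda>p. num (fst p))"
        by (intro continuous_on_compose2[OF num_continuous_X] continuous_intros) (auto simp: K_def)
      show "continuous_on K (\<lambda>p. eta_real g (fst p) (snd p))"
        using continuous_on_subset[OF eta_real_continuous, of K] by (simp add: K_def case_prod_beta)
      show "\<forall>p\<in>K. eta_real g (fst p) (snd p) \<noteq> 0" using c(1) by (auto simp: K_def)
    qed
    ultimately have "uniformly_continuous_on K (\<lambda>(z, v). num z / eta_real g z v)"
      by (intro compact_uniformly_continuous)
    then obtain d where d: "0 < d" "\<forall>p\<in>K. \<forall>p'\<in>K. dist p' p < d \<longrightarrow>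
        dist (case p' of (z, v) \<Rightarrow> num z / eta_real g z v) (case p of (z, v) \<Rightarrow> num z / eta_real g z v) < \<epsilon>"
      using \<epsilon> unfolding uniformly_continuous_on_def by (elim allE[where x = \<epsilon>]) blast
    have K: "(x t, y t) \<in> K" for t
      using iterates c(2)[of t] by (simp add: K_def e_def)
    show ?thesis
    proof (intro exI[of _ d] conjI allI impI d(1))
      fix t assume "dist (x (Suc t), y (Suc t)) (x t, y t) < d"
      then show "\<bar>q (Suc t) - q t\<bar> < \<epsilon>"
        using d(2)[rule_format, OF K[of t] K[of "Suc t"]] by (simp add: q_def e_def dist_real_def)
    qed
  qed
  show ?thesis
    by (rule nonmonotone_descent[where u = "\<lambda>t. (x t, y t)" and q = q and M = M,
          OF q_nonneg sufficient_descent(1) _ unif c])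
      (rule sufficient_descent(2)[unfolded W_def])
qed

section \<open>Step sizes accepted by the line search\<close>

definition w :: "nat \<Rightarrow> real ^ 'n" where "w t = grad h (x t) - q t *\<^sub>R y t"

text \<open>Rewrites the centers of the proximal maps through \<open>w t\<close>, the gradient at
  \<open>x t\<close> of \<open>h\<close> minus \<open>q t\<close> times \<open>\<eta>\<close> with
  \<open>y t\<close> fixed: a primal step is a proximal gradient step on numerator minus current
  quotient times denominator, as in Dinkelbach's method.\<close>

lemma primal_candidates:
  assumes t: "t mod (N + 1) \<noteq> 0" and i: "i = t mod (N + 1)"
  obtains \<alpha> m z where "\<alpha>min \<le> \<alpha>"
    "\<And>k. k \<le> m \<Longrightarrow> z k \<in> prox_on (block_space (B i)) (\<lambda>v. ereal (\<alpha> * \<gamma> ^ k) * fs i v)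
        (block (B i) (x t) - (\<alpha> * \<gamma> ^ k) *\<^sub>R block (B i) (w t))"
    "\<And>k. k < m \<Longrightarrow> \<not> ls_accept f g h \<sigma> (ereal (W t)) (x t) (y t) (replace_block (B i) (x t) (z k))"
    "x (Suc t) = replace_block (B i) (x t) (z m)"
proof -
  have "step_X (B i) (fs i) f g h \<alpha>min \<alpha>max \<sigma> \<gamma> (ereal (q t)) (ereal (W t)) (x t) (y t) (x (Suc t)) (y (Suc t))"
    using step[of t] t window(1)[of t] admissible_Q[OF admissible, of t] by (simp add: i)
  then obtain \<alpha> m z where A: "\<alpha> \<in> {\<alpha>min..\<alpha>max}"
    "\<forall>k\<le>m. z k \<in> prox_on (block_space (B i)) (\<lambda>v. ereal (\<alpha> * \<gamma> ^ k) * fs i v)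
        (block (B i) (x t) - (\<alpha> * \<gamma> ^ k) *\<^sub>R block (B i) (grad h (x t))
          + (\<alpha> * \<gamma> ^ k * q t) *\<^sub>R block (B i) (y t))"
    "\<forall>k<m. \<not> ls_accept f g h \<sigma> (ereal (W t)) (x t) (y t) (replace_block (B i) (x t) (z k))"
    "x (Suc t) = replace_block (B i) (x t) (z m)"
    unfolding step_X_def real_of_ereal.simps by blast
  have center: "block (B i) (x t) - a *\<^sub>R block (B i) (grad h (x t)) + (a * q t) *\<^sub>R block (B i) (y t)
      = block (B i) (x t) - a *\<^sub>R block (B i) (w t)" for a
    by (simp add: w_def block_def vec_eq_iff algebra_simps)
  show thesis
    by (rule that[of \<alpha> m z]) (use A in \<open>simp_all add: center\<close>)
qed

lemma index_in_blocks: "t mod (N + 1) \<noteq> 0 \<Longrightarrow> t mod (N + 1) \<in> {1..N}"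
  using mod_less_divisor[of "N + 1" t] by (simp del: mod_less_divisor)

lemma w_bounded: obtains V where "0 \<le> V" "\<And>t. norm (w t) \<le> V"
proof -
  have "continuous_on X (grad h)"
    using loc_lipschitz_differentiable_continuous(2)[OF h_diff open_Omega] X_D
    by (auto elim: continuous_on_subset)
  then have "bounded (grad h ` X)"
    using level_compact compact_continuous_image compact_imp_bounded by blast
  then obtain G where G: "\<And>z. z \<in> X \<Longrightarrow> norm (grad h z) \<le> G" by (auto simp: bounded_iff)
  obtain D where D: "\<And>v. v \<in> Y \<Longrightarrow> norm v \<le> D"
    using compact_imp_bounded[OF compact_Y] by (auto simp: bounded_iff)
  have "norm (w t) \<le> G + q 0 * D" for t
  proof -
    have "norm (w t) \<le> norm (grad h (x t)) + norm (q t *\<^sub>R y t)" unfolding w_def by (rule norm_triangle_ineq4)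
    also have "norm (q t *\<^sub>R y t) = q t * norm (y t)" using q_nonneg[of t] by simp
    also have "q t * norm (y t) \<le> q 0 * D"
      using admissible[of t] q_nonneg D[OF iterates(2), of t] by (intro mult_mono) (auto simp: admissible_def)
    finally show ?thesis using G[OF iterates(1), of t] by simp
  qed
  then show thesis using that[of "G + q 0 * D"] norm_ge_zero order.trans by blast
qed

text \<open>For a small step size the candidate stays in a ball around \<open>z0\<close> on which \<open>\<nabla>h\<close> is Lipschitz,
  and is then accepted.\<close>

lemma small_steps_accepted:
  assumes z0: "z0 \<in> X"
  obtains \<rho> a0 where "0 < \<rho>" "0 < a0"
    "\<And>t a v i. t mod (N + 1) \<noteq> 0 \<Longrightarrow> i = t mod (N + 1) \<Longrightarrow> dist (x t) z0 < \<rho> \<Longrightarrow> 0 < a \<Longrightarrow> a \<le> a0 \<Longrightarrow>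
      v \<in> prox_on (block_space (B i)) (\<lambda>v. ereal a * fs i v) (block (B i) (x t) - a *\<^sub>R block (B i) (w t)) \<Longrightarrow>
      ls_accept f g h \<sigma> (ereal (W t)) (x t) (y t) (replace_block (B i) (x t) v)"
proof -
  obtain \<rho> L where \<rho>: "0 < \<rho>" "0 \<le> L" "ball z0 \<rho> \<subseteq> Omega g"
    and bound: "\<And>u v. u \<in> ball z0 \<rho> \<Longrightarrow> v \<in> ball z0 \<rho> \<Longrightarrow>
       \<bar>real_of_ereal (h v) - real_of_ereal (h u) - grad h u \<bullet> (v - u)\<bar> \<le> L * (norm (v - u))\<^sup>2"
    using loc_lipschitz_differentiable_ball[OF h_diff open_Omega X_D(2)[OF z0]] by metis
  obtain V where V: "0 \<le> V" "\<And>t. norm (w t) \<le> V" using w_bounded by blast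
  have "X \<subseteq> effdom f \<inter> Omega g" using X_D by blast
  then obtain C where C: "0 \<le> C"
    "\<And>i z v. i \<in> {1..N} \<Longrightarrow> z \<in> X \<Longrightarrow> v \<in> block_space (B i) \<Longrightarrow> fs i v < \<infinity> \<Longrightarrow>
      real_of_ereal (fs i (block (B i) z)) - real_of_ereal (fs i v) \<le> C"
    using block_values_gap[OF level_compact] by metis
  \<comment> \<open>If \<open>d \<ge> \<rho> / 2\<close>, then
    \<open>C + V * d \<le> T * (d * \<rho> / 4)\<close>, whereas \<open>d\<^sup>2 / (2 * a)\<close>
    is at least \<open>d * \<rho> / 4\<close> divided by \<open>a\<close>. So
    \<open>1 / a > T\<close> keeps the candidate in the ball; the summands
    \<open>2 * L + \<sigma>\<close> in \<open>a0\<close> provide the curvature condition for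
    acceptance.\<close>
  define T where "T = 4 / \<rho> * (2 * C / \<rho> + V)"
  define a0 where "a0 = 1 / (T + 1 + 2 * L + \<sigma>)"
  have T: "0 \<le> T" using \<rho> C V by (simp add: T_def)
  show thesis
  proof (rule that[of "\<rho> / 2" a0])
    show "0 < \<rho> / 2" using \<rho> by simp
    show "0 < a0" using T \<rho> \<sigma>_pos by (simp add: a0_def)
    fix t a v i
    assume t: "t mod (N + 1) \<noteq> 0" and it: "i = t mod (N + 1)" and near: "dist (x t) z0 < \<rho> / 2"
      and a: "0 < a" "a \<le> a0"
      and v: "v \<in> prox_on (block_space (B i)) (\<lambda>v. ereal a * fs i v) (block (B i) (x t) - a *\<^sub>R block (B i) (w t))"
    have i: "i \<in> {1..N}" using index_in_blocks[OF t] it by simp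
    have inv_a: "T + 1 + 2 * L + \<sigma> \<le> 1 / a"
      using a T \<rho> \<sigma>_pos by (simp add: a0_def field_simps)
    let ?bx = "block (B i) (x t)"
    define d where "d = norm (v - ?bx)"
    note prox = prox_on_gradient_step[OF a(1) fs_proper[OF i] v]
    have v_fin: "fs i v < \<infinity>" using prox(2) by auto
    have bx_fin: "fs i ?bx < \<infinity>" using iterates(5)[of t] i by (simp add: effdom_f_iff)
    have desc: "real_of_ereal (fs i v) + block (B i) (w t) \<bullet> (v - ?bx) + d\<^sup>2 / (2 * a)
        \<le> real_of_ereal (fs i ?bx)"
      using prox(3)[OF block_in_block_space bx_fin] by (simp add: d_def)
    have "\<bar>block (B i) (w t) \<bullet> (v - ?bx)\<bar> \<le> V * d"
      unfolding d_def
      by (rule order.trans[OF Cauchy_Schwarz_ineq2 mult_right_mono[OF order.trans[OF norm_block_le V(2)] norm_ge_zero]])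
    then have quad: "d\<^sup>2 / (2 * a) \<le> C + V * d"
      using desc C(2)[OF i iterates(1) prox(1) v_fin, of t] by linarith
    have d_small: "d < \<rho> / 2"
    proof (rule ccontr)
      assume "\<not> d < \<rho> / 2"
      then have d: "\<rho> / 2 \<le> d" "0 < d" using \<rho> by auto
      have "(T + 1) * (d * \<rho> / 4) \<le> 1 / a * (d * \<rho> / 4)"
        using inv_a \<rho> d \<sigma>_pos by (intro mult_right_mono) auto
      also have "\<dots> = d * (\<rho> / 2) / (2 * a)" by simp
      also have "\<dots> \<le> d\<^sup>2 / (2 * a)"
        using d a unfolding power2_eq_square by (intro divide_right_mono mult_left_mono) auto
      also have "\<dots> \<le> C + V * d" by (rule quad)
      also have "C \<le> C * (2 * d / \<rho>)" using mult_left_mono[of 1 "2 * d / \<rho>" C] C(1) d \<rho> by simp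
      also have "C * (2 * d / \<rho>) + V * d = T * (d * \<rho> / 4)" using \<rho> by (simp add: T_def field_simps)
      finally have "d * \<rho> / 4 \<le> 0" by (simp add: algebra_simps)
      then show False using d(2) \<rho> by (simp add: mult_le_0_iff)
    qed
    let ?r = "replace_block (B i) (x t) v"
    have "dist ?r (x t) = d" using replace_block_diff[OF prox(1)] by (simp add: dist_norm d_def)
    then have r: "?r \<in> ball z0 \<rho>" "x t \<in> ball z0 \<rho>"
      using near d_small dist_triangle[of ?r z0 "x t"] \<rho>(1) by (auto simp: dist_commute)
    show "ls_accept f g h \<sigma> (ereal (W t)) (x t) (y t) ?r"
    proof (rule line_search_accepts[where q = "q t" and a = a and L = L])
      show "0 < eta_real g (x t) (y t)" using iterates(3) by (simp add: e_def)
      show "q t = num (x t) / eta_real g (x t) (y t)" by (simp add: q_def e_def)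
      show "\<bar>h ?r\<bar> \<noteq> \<infinity>" by (rule h_finite[OF subsetD[OF \<rho>(3) r(1)]])
      show "real_of_ereal (fs i v) + block (B i) (grad h (x t) - q t *\<^sub>R y t) \<bullet> (v - ?bx)
          + (norm (v - ?bx))\<^sup>2 / (2 * a) \<le> real_of_ereal (fs i ?bx)"
        using desc by (simp add: w_def d_def)
      show "real_of_ereal (h ?r) \<le> real_of_ereal (h (x t)) + grad h (x t) \<bullet> (?r - x t)
          + L * (norm (?r - x t))\<^sup>2"
        using bound[OF r(2,1)] by linarith
      show "L + \<sigma> / 2 \<le> 1 / (2 * a)" using inv_a T by simp
    qed (use iterates i prox(1) v_fin window(4) \<sigma>_pos in auto)
  qed
qed

text \<open>A lower bound on accepted step sizes makes the quadratic coefficient \<open>K\<close>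
  uniform in \<open>t\<close>. The linear term is recentered at the new block, and the left side
  stays extended-real, ready for a limit by lower semicontinuity.\<close>

lemma step_size_bound:
  assumes z0: "z0 \<in> X"
  obtains \<rho> K where "0 < \<rho>" "0 \<le> K"
    "\<And>t i v. t mod (N + 1) \<noteq> 0 \<Longrightarrow> i = t mod (N + 1) \<Longrightarrow> dist (x t) z0 < \<rho> \<Longrightarrow>
      v \<in> block_space (B i) \<Longrightarrow> fs i v < \<infinity> \<Longrightarrow>
      fs i (block (B i) (x (Suc t))) \<le> ereal (real_of_ereal (fs i v)
        + block (B i) (w t) \<bullet> (v - block (B i) (x (Suc t))) + K * (norm (v - block (B i) (x t)))\<^sup>2)"
proof -
  obtain \<rho> a0 where \<rho>: "0 < \<rho>" "0 < a0" and acc: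
    "\<And>t a v i. t mod (N + 1) \<noteq> 0 \<Longrightarrow> i = t mod (N + 1) \<Longrightarrow> dist (x t) z0 < \<rho> \<Longrightarrow> 0 < a \<Longrightarrow> a \<le> a0 \<Longrightarrow>
      v \<in> prox_on (block_space (B i)) (\<lambda>v. ereal a * fs i v) (block (B i) (x t) - a *\<^sub>R block (B i) (w t)) \<Longrightarrow>
      ls_accept f g h \<sigma> (ereal (W t)) (x t) (y t) (replace_block (B i) (x t) v)"
    using small_steps_accepted[OF z0] by blast
  define abar where "abar = min \<alpha>min (\<gamma> * a0)"
  have abar: "0 < abar" using \<alpha>_bounds \<gamma>_bounds \<rho> by (simp add: abar_def)
  show thesis
  proof (rule that[of \<rho> "1 / (2 * abar)"])
    show "0 < \<rho>" by (rule \<rho>)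
    show "0 \<le> 1 / (2 * abar)" using abar by simp
    fix t i v
    assume t: "t mod (N + 1) \<noteq> 0" and it: "i = t mod (N + 1)" and near: "dist (x t) z0 < \<rho>"
      and v: "v \<in> block_space (B i)" "fs i v < \<infinity>"
    have i: "i \<in> {1..N}" using index_in_blocks[OF t] it by simp
    obtain \<alpha> m z where \<alpha>: "\<alpha>min \<le> \<alpha>"
      and prox: "\<And>k. k \<le> m \<Longrightarrow> z k \<in> prox_on (block_space (B i)) (\<lambda>v. ereal (\<alpha> * \<gamma> ^ k) * fs i v)
        (block (B i) (x t) - (\<alpha> * \<gamma> ^ k) *\<^sub>R block (B i) (w t))"
      and rej: "\<And>k. k < m \<Longrightarrow> \<not> ls_accept f g h \<sigma> (ereal (W t)) (x t) (y t) (replace_block (B i) (x t) (z k))"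
      and x': "x (Suc t) = replace_block (B i) (x t) (z m)"
      using primal_candidates[OF t it] by blast
    define a where "a = \<alpha> * \<gamma> ^ m"
    have pos: "0 < \<alpha> * \<gamma> ^ k" for k using \<alpha> \<alpha>_bounds \<gamma>_bounds by simp
    have "abar \<le> a"
    \<comment> \<open>Without reductions the step size is at least \<open>\<alpha>min\<close>;
      otherwise the last rejected one exceeds \<open>a0\<close>, and one factor
      \<open>\<gamma>\<close> separates it from the accepted one.\<close>
    proof (cases m)
      case 0
      then show ?thesis using \<alpha> by (simp add: a_def abar_def)
    next
      case (Suc k)
      then have "a0 < \<alpha> * \<gamma> ^ k"
        using rej[of k] acc[OF t it near pos _ prox[of k]] by (meson lessI less_imp_le not_le)
      then have "\<gamma> * a0 \<le> a" using \<gamma>_bounds Suc by (simp add: a_def)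
      then show ?thesis by (simp add: abar_def)
    qed
    have a: "0 < a" using pos by (simp add: a_def)
    note P = prox_on_gradient_step[OF a fs_proper[OF i], of "z m" "block (B i) (x t)" "block (B i) (w t)",
        folded a_def, OF prox[OF order.refl, folded a_def]]
    have zm: "block (B i) (x (Suc t)) = z m" using block_replace_block[OF P(1)] x' by simp
    let ?bx = "block (B i) (x t)" and ?w = "block (B i) (w t)"
    have "(norm (v - ?bx))\<^sup>2 / (2 * a) \<le> (norm (v - ?bx))\<^sup>2 / (2 * abar)"
      using \<open>abar \<le> a\<close> abar a by (intro divide_left_mono) auto
    moreover have "0 \<le> (norm (z m - ?bx))\<^sup>2 / (2 * a)" using a by simp
    moreover have "?w \<bullet> (v - ?bx) = ?w \<bullet> (v - z m) + ?w \<bullet> (z m - ?bx)" by (simp add: inner_diff_right)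
    ultimately have "real_of_ereal (fs i (z m)) \<le> real_of_ereal (fs i v) + ?w \<bullet> (v - z m)
        + 1 / (2 * abar) * (norm (v - ?bx))\<^sup>2"
      using P(3)[OF v] by simp
    then show "fs i (block (B i) (x (Suc t))) \<le> ereal (real_of_ereal (fs i v)
        + ?w \<bullet> (v - block (B i) (x (Suc t))) + 1 / (2 * abar) * (norm (v - ?bx))\<^sup>2)"
      using P(2) unfolding zm by (cases "fs i (z m)") auto
  qed
qed

text \<open>Stated for an arbitrary index sequence \<open>s\<close>, as it is applied both to
  \<open>r\<close> and to the shifted sequences that select one phase of the cycle.\<close>

lemma accumulation_point:
  assumes "(\<lambda>k. (x (s k), y (s k))) \<longlonglongrightarrow> (xs, ys)"
  shows "xs \<in> X" "ys \<in> Y" "0 < eta_real g xs ys"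
    "(\<lambda>k. q (s k)) \<longlonglongrightarrow> num xs / eta_real g xs ys"
proof -
  have xs: "(\<lambda>k. x (s k)) \<longlonglongrightarrow> xs" and ys: "(\<lambda>k. y (s k)) \<longlonglongrightarrow> ys"
    using tendsto_fst[OF assms] tendsto_snd[OF assms] by simp_all
  show X: "xs \<in> X"
    using closed_sequentially[OF compact_imp_closed[OF level_compact] _ xs] iterates by blast
  show Y: "ys \<in> Y"
    using closed_sequentially[OF compact_imp_closed[OF compact_Y] _ ys] iterates by blast
  have e_lim: "(\<lambda>k. e (s k)) \<longlonglongrightarrow> eta_real g xs ys"
    using continuous_on_tendsto_compose[OF eta_real_continuous assms] X Y iterates
    by (simp add: e_def)
  obtain c where c: "0 < c" "\<And>t. c \<le> e t" using e_lower_bound by blast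
  have "c \<le> eta_real g xs ys" using tendsto_lowerbound[OF e_lim] c(2) by simp
  then show pos: "0 < eta_real g xs ys" using c(1) by simp
  have "(\<lambda>k. num (x (s k))) \<longlonglongrightarrow> num xs"
    using continuous_on_tendsto_compose[OF num_continuous_X xs X] iterates by simp
  then show "(\<lambda>k. q (s k)) \<longlonglongrightarrow> num xs / eta_real g xs ys"
    unfolding q_def using pos by (intro tendsto_divide e_lim) auto
qed

section \<open>Accumulation points at which \<open>f + h\<close> is positive\<close>

context
  fixes r :: "nat \<Rightarrow> nat" and xs ys
  assumes r: "strict_mono r" and lim: "(\<lambda>k. (x (r k), y (r k))) \<longlonglongrightarrow> (xs, ys)"
    and num_pos: "0 < num xs"
begin

text \<open>Along \<open>r\<close> the quotients tend to a positive limit, so infinitely many of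
  them exceed half of it; this rules out a zero limit of the window maxima.\<close>

lemma accumulation_steps_vanish: "(\<lambda>t. dist (x (Suc t), y (Suc t)) (x t, y t)) \<longlonglongrightarrow> 0"
proof -
  let ?Q = "num xs / eta_real g xs ys"
  have Q: "0 < ?Q" using num_pos accumulation_point(3)[OF lim] by simp
  have "\<forall>\<^sub>F k in sequentially. ?Q / 2 < q (r k)"
    using order_tendstoD(1)[OF accumulation_point(4)[OF lim], of "?Q / 2"] Q by simp
  then obtain k0 where k0: "\<And>k. k0 \<le> k \<Longrightarrow> ?Q / 2 < q (r k)" by (auto simp: eventually_sequentially)
  have "\<exists>\<^sub>F t in sequentially. ?Q / 2 \<le> q t"
    unfolding frequently_sequentially
  proof
    fix n
    have "n \<le> r (max n k0)" using seq_suble[OF r, of "max n k0"] by simp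
    then show "\<exists>t\<ge>n. ?Q / 2 \<le> q t" using k0[of "max n k0"] by (intro exI[of _ "r (max n k0)"]) simp
  qed
  then show ?thesis using Q by (intro steps_vanish[of "?Q / 2"]) auto
qed

lemma accumulation_shift: "(\<lambda>k. (x (r k + j), y (r k + j))) \<longlonglongrightarrow> (xs, ys)"
proof (induction j)
  case 0
  then show ?case using lim by simp
next
  case (Suc j)
  have "filterlim (\<lambda>k. r k + j) at_top sequentially"
    by (rule filterlim_at_top_mono[OF filterlim_subseq[OF r]]) simp
  then have "(\<lambda>k. dist (x (Suc (r k + j)), y (Suc (r k + j))) (x (r k + j), y (r k + j))) \<longlonglongrightarrow> 0"
    by (rule filterlim_compose[OF accumulation_steps_vanish])
  from tendsto_add[OF this tendsto_dist_iff[THEN iffD1, OF Suc.IH]]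
  have "(\<lambda>k. dist (x (Suc (r k + j)), y (Suc (r k + j))) (x (r k + j), y (r k + j))
      + dist (x (r k + j), y (r k + j)) (xs, ys)) \<longlonglongrightarrow> 0" by simp
  then have "(\<lambda>k. dist (x (Suc (r k + j)), y (Suc (r k + j))) (xs, ys)) \<longlonglongrightarrow> 0"
    by (rule tendsto_sandwich[OF _ _ tendsto_const, rotated 2]) (auto simp: dist_triangle)
  then show ?case by (subst tendsto_dist_iff) simp
qed

text \<open>The offset may vary with \<open>k\<close> but takes finitely many values, so the
  fixed-offset limits hold simultaneously from some index on.\<close>

lemma accumulation_bounded_shift:
  assumes j: "\<And>k. j k \<le> J"
  shows "(\<lambda>k. (x (r k + j k), y (r k + j k))) \<longlonglongrightarrow> (xs, ys)"
  unfolding tendsto_iff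
proof (intro allI impI)
  fix \<epsilon> :: real assume "0 < \<epsilon>"
  then have "\<forall>\<^sub>F k in sequentially. \<forall>i\<in>{..J}. dist (x (r k + i), y (r k + i)) (xs, ys) < \<epsilon>"
    using tendstoD[OF accumulation_shift] by (intro eventually_ball_finite) auto
  then show "\<forall>\<^sub>F k in sequentially. dist (x (r k + j k), y (r k + j k)) (xs, ys) < \<epsilon>"
    by eventually_elim (use j in auto)
qed

lemma accumulation_phase:
  assumes "i \<le> N"
  obtains s where "\<And>k. s k mod (N + 1) = i" "(\<lambda>k. (x (s k), y (s k))) \<longlonglongrightarrow> (xs, ys)"
    "(\<lambda>k. (x (Suc (s k)), y (Suc (s k)))) \<longlonglongrightarrow> (xs, ys)"
proof -
  \<comment> \<open>Modulo \<open>N + 1\<close> the factor \<open>N\<close> acts as -1, so this is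
    the residue of \<open>i - r k\<close> written without subtraction on naturals.\<close>
  define j where "j k = (i + N * r k) mod (N + 1)" for k
  have j: "j k \<le> N" for k using mod_less_divisor[of "N + 1"] unfolding j_def by (metis Suc_eq_plus1 less_Suc_eq_le zero_less_Suc)
  have "(r k + j k) mod (N + 1) = i" for k
  proof -
    have "(r k + j k) mod (N + 1) = (r k + (i + N * r k)) mod (N + 1)"
      unfolding j_def by (rule mod_add_right_eq)
    also have "r k + (i + N * r k) = i + (N + 1) * r k" by simp
    also have "\<dots> mod (N + 1) = i" using assms by (simp only: mod_mult_self2) simp
    finally show ?thesis .
  qed
  moreover have "(\<lambda>k. (x (Suc (r k + j k)), y (Suc (r k + j k)))) \<longlonglongrightarrow> (xs, ys)"
    using accumulation_bounded_shift[of "\<lambda>k. Suc (j k)" "Suc N"] j by simp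
  ultimately show thesis
    using that[of "\<lambda>k. r k + j k"] accumulation_bounded_shift[of j N] j by blast
qed

text \<open>In the dual phase the base points differ from \<open>x (s k)\<close> by at most the dual
  step divided by \<open>\<alpha>min\<close>, so they also tend to \<open>xs\<close>.\<close>

lemma accumulation_subdiff: "ys \<in> convex_subdiff g xs"
proof -
  obtain s where s: "\<And>k. s k mod (N + 1) = 0" and lims: "(\<lambda>k. (x (s k), y (s k))) \<longlonglongrightarrow> (xs, ys)"
    "(\<lambda>k. (x (Suc (s k)), y (Suc (s k)))) \<longlonglongrightarrow> (xs, ys)"
    using accumulation_phase[of 0] by auto
  have lx: "(\<lambda>k. x (s k)) \<longlonglongrightarrow> xs" and ly: "(\<lambda>k. y (s k)) \<longlonglongrightarrow> ys" "(\<lambda>k. y (Suc (s k))) \<longlonglongrightarrow> ys"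
    using tendsto_fst[OF lims(1)] tendsto_snd[OF lims(1)] tendsto_snd[OF lims(2)] by simp_all
  have "\<exists>\<alpha>. \<alpha>min \<le> \<alpha> \<and> y (Suc (s k)) \<in> convex_subdiff g (x (s k) + (y (s k) - y (Suc (s k))) /\<^sub>R \<alpha>)" for k
    using dual_step(2)[OF s[of k]] by auto
  then obtain \<alpha> where \<alpha>: "\<And>k. \<alpha>min \<le> \<alpha> k"
    and sub: "\<And>k. y (Suc (s k)) \<in> convex_subdiff g (x (s k) + (y (s k) - y (Suc (s k))) /\<^sub>R \<alpha> k)"
    by metis
  have "(\<lambda>k. norm (y (s k) - y (Suc (s k))) / \<alpha>min) \<longlonglongrightarrow> norm (ys - ys) / \<alpha>min"
    using \<alpha>_bounds by (intro tendsto_intros ly) auto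
  then have "(\<lambda>k. norm (y (s k) - y (Suc (s k))) / \<alpha>min) \<longlonglongrightarrow> 0" by simp
  moreover have le: "norm ((y (s k) - y (Suc (s k))) /\<^sub>R \<alpha> k) \<le> norm (y (s k) - y (Suc (s k))) / \<alpha>min" for k
  proof -
    have "norm ((y (s k) - y (Suc (s k))) /\<^sub>R \<alpha> k) = norm (y (s k) - y (Suc (s k))) / \<alpha> k"
      using \<alpha>[of k] \<alpha>_bounds by (simp add: divide_inverse mult.commute)
    also have "\<dots> \<le> norm (y (s k) - y (Suc (s k))) / \<alpha>min"
      using \<alpha>[of k] \<alpha>_bounds by (intro divide_left_mono) auto
    finally show ?thesis .
  qed
  ultimately have "(\<lambda>k. (y (s k) - y (Suc (s k))) /\<^sub>R \<alpha> k) \<longlonglongrightarrow> 0"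
    by (intro Lim_null_comparison[OF always_eventually[OF allI[OF le]]])
  from tendsto_add[OF lx this] show ?thesis
    using convex_subdiff_closed[OF g_cont _ ly(2)] sub by simp
qed

lemma accumulation_frechet: "- (grad h xs - (num xs / eta_real g xs ys) *\<^sub>R ys) \<in> frechet_subdiff f xs"
proof -
  have xsX: "xs \<in> X" using accumulation_point[OF lim] by simp
  define ws where "ws = grad h xs - (num xs / eta_real g xs ys) *\<^sub>R ys"
  obtain \<rho> K where \<rho>: "0 < \<rho>" and ineq:
    "\<And>t i v. t mod (N + 1) \<noteq> 0 \<Longrightarrow> i = t mod (N + 1) \<Longrightarrow> dist (x t) xs < \<rho> \<Longrightarrow>
      v \<in> block_space (B i) \<Longrightarrow> fs i v < \<infinity> \<Longrightarrow>
      fs i (block (B i) (x (Suc t))) \<le> ereal (real_of_ereal (fs i v)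
        + block (B i) (w t) \<bullet> (v - block (B i) (x (Suc t))) + K * (norm (v - block (B i) (x t)))\<^sup>2)"
    using step_size_bound[OF xsX] by metis
  have "- ws \<in> frechet_subdiff f xs"
  proof (rule frechet_subdiff_of_blocks[OF X_D(1)[OF xsX]])
    fix i v assume i: "i \<in> {1..N}" and v: "v \<in> block_space (B i)" "fs i v < \<infinity>"
    \<comment> \<open>Each block has its own index sequence, but all converge to the same pair, so
      the limiting inequalities share the point \<open>xs\<close> and the vector
      \<open>ws\<close>.\<close>
    obtain s where s: "\<And>k. s k mod (N + 1) = i" and lims: "(\<lambda>k. (x (s k), y (s k))) \<longlonglongrightarrow> (xs, ys)"
      "(\<lambda>k. (x (Suc (s k)), y (Suc (s k)))) \<longlonglongrightarrow> (xs, ys)"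
      using accumulation_phase[of i] i by auto
    have lx: "(\<lambda>k. x (s k)) \<longlonglongrightarrow> xs" "(\<lambda>k. x (Suc (s k))) \<longlonglongrightarrow> xs" and ly: "(\<lambda>k. y (s k)) \<longlonglongrightarrow> ys"
      using tendsto_fst[OF lims(1)] tendsto_fst[OF lims(2)] tendsto_snd[OF lims(1)] by simp_all
    have "isCont (grad h) xs"
      using loc_lipschitz_differentiable_continuous(2)[OF h_diff open_Omega] X_D(2)[OF xsX] open_Omega
      by (simp add: continuous_on_eq_continuous_at)
    then have "(\<lambda>k. grad h (x (s k))) \<longlonglongrightarrow> grad h xs" using lx(1) by (rule isCont_tendsto_compose)
    then have lw: "(\<lambda>k. w (s k)) \<longlonglongrightarrow> ws"
      unfolding w_def ws_def by (intro tendsto_intros accumulation_point(4)[OF lims(1)] ly)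
    have lb: "(\<lambda>k. block (B i) (u k)) \<longlonglongrightarrow> block (B i) u0" if "u \<longlonglongrightarrow> u0" for u u0
      using linear_continuous_at[OF linear_conv_bounded_linear[THEN iffD1, OF linear_block]] that
      by (rule isCont_tendsto_compose)
    have "fs i (block (B i) xs) \<le> ereal (real_of_ereal (fs i v)
        + block (B i) ws \<bullet> (v - block (B i) xs) + K * (norm (v - block (B i) xs))\<^sup>2)"
    proof (rule lsc_on_sequential[OF fs_lsc[OF i] block_in_block_space block_in_block_space lb[OF lx(2)]])
      show "\<forall>\<^sub>F k in sequentially. fs i (block (B i) (x (Suc (s k)))) \<le> ereal (real_of_ereal (fs i v)
        + block (B i) (w (s k)) \<bullet> (v - block (B i) (x (Suc (s k)))) + K * (norm (v - block (B i) (x (s k))))\<^sup>2)"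
        using tendstoD[OF lx(1) \<rho>]
      proof eventually_elim
        case (elim k)
        then show ?case using ineq[OF _ s[symmetric] _ v] s[of k] i by simp
      qed
      show "(\<lambda>k. ereal (real_of_ereal (fs i v)
        + block (B i) (w (s k)) \<bullet> (v - block (B i) (x (Suc (s k)))) + K * (norm (v - block (B i) (x (s k))))\<^sup>2))
        \<longlonglongrightarrow> ereal (real_of_ereal (fs i v)
        + block (B i) ws \<bullet> (v - block (B i) xs) + K * (norm (v - block (B i) xs))\<^sup>2)"
        by (intro tendsto_intros lb lx lw)
    qed
    then show "real_of_ereal (fs i (block (B i) xs)) \<le> real_of_ereal (fs i v)
        + block (B i) ws \<bullet> (v - block (B i) xs) + K * (norm (v - block (B i) xs))\<^sup>2"
      by (subst (asm) fs_real[OF X_D(1)[OF xsX] i]) simp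
  qed
  then show ?thesis by (simp add: ws_def)
qed

end

lemma convergence:
  assumes r: "strict_mono r" and lim: "(\<lambda>k. (x (r k), y (r k))) \<longlonglongrightarrow> (xs, ys)"
  shows "(xs, ys) \<in> S_set g X gbar \<alpha>min" "(INF t. eta g (x t) (y t)) > 0"
    "xs \<in> effdom (F_obj f g h)" "critical_point f g h xs"
    "real_of_ereal (F_obj f g h xs) *\<^sub>R ys
      \<in> (\<lambda>w. real_of_ereal (F_obj f g h xs) *\<^sub>R w) ` convex_subdiff g xs"
proof -
  note acc = accumulation_point[OF lim]
  show "(xs, ys) \<in> S_set g X gbar \<alpha>min"
    using acc(1-3) eta_eq_eta_real[OF Y_effdom[OF acc(2)], of xs] by (simp add: S_set_def)
  obtain c where c: "0 < c" "\<And>t. c \<le> e t" using e_lower_bound by blast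
  have "ereal c \<le> (INF t. eta g (x t) (y t))"
    using c(2) eta_eq_eta_real[OF iterates(4)] by (intro INF_greatest) (simp add: e_def)
  then show "(INF t. eta g (x t) (y t)) > 0" using less_le_trans[of 0 "ereal c"] c(1) by simp
  have xs: "xs \<in> effdom f" "xs \<in> Omega g" using X_D acc(1) by blast+
  then show dom: "xs \<in> effdom (F_obj f g h)" by (simp add: effdom_F_obj)
  have F: "real_of_ereal (F_obj f g h xs) = num xs / g xs" using F_obj_real[OF xs] by simp
  have crit: "critical_point f g h xs"
    if "- (grad h xs - (num xs / g xs) *\<^sub>R v) \<in> frechet_subdiff f xs" "v \<in> convex_subdiff g xs" for v
  proof -
    have "0 = - (grad h xs - (num xs / g xs) *\<^sub>R v) + grad h xs - (num xs / g xs) *\<^sub>R v" by simp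
    then show ?thesis using dom that unfolding critical_point_def F by blast
  qed
  have "critical_point f g h xs \<and> (num xs / g xs) *\<^sub>R ys \<in> (\<lambda>w. (num xs / g xs) *\<^sub>R w) ` convex_subdiff g xs"
  proof (cases "num xs = 0")
    case True
    obtain v where "v \<in> convex_subdiff g xs" using convex_subdiff_nonempty[OF g_convex] by blast
    \<comment> \<open>The zero value annihilates the subgradient term, so any \<open>v\<close>
      serves for criticality and the dual claim reads that zero lies in the image.\<close>
    then show ?thesis using crit[of v] frechet_subdiff_of_num_zero[OF xs True] True by auto
  next
    case False
    then have pos: "0 < num xs" using num_nonneg[OF acc(1)] by simp
    have sub: "ys \<in> convex_subdiff g xs" by (rule accumulation_subdiff[OF r lim pos])
    \<comment> \<open>Membership of \<open>ys\<close> in the subdifferential makes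
      \<open>eta_real g xs ys\<close> equal to \<open>g xs\<close>, which turns the limit of
      \<open>q\<close> into the value of \<open>F\<close> at \<open>xs\<close>.\<close>
    then show ?thesis
      using crit[of ys] accumulation_frechet[OF r lim pos] eta_real_subdiff[OF sub] by auto
  qed
  then show "critical_point f g h xs" "real_of_ereal (F_obj f g h xs) *\<^sub>R ys
      \<in> (\<lambda>w. real_of_ereal (F_obj f g h xs) *\<^sub>R w) ` convex_subdiff g xs"
    by (simp_all add: F)
qed

end

theorem theorem5p2:
  fixes f h :: "real ^ 'n::finite \<Rightarrow> ereal"
    and g :: "real ^ 'n \<Rightarrow> real"
    and N :: nat and B :: "nat \<Rightarrow> 'n set" and fs :: "nat \<Rightarrow> real ^ 'n \<Rightarrow> ereal"
    and \<alpha>min \<alpha>max \<sigma> \<gamma> gbar :: real and M :: nat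
    and x y :: "nat \<Rightarrow> real ^ 'n"
    and xs ys :: "real ^ 'n"
    and r :: "nat \<Rightarrow> nat"
  assumes f_proper: "proper_on UNIV f" and f_lsc: "lsc_on UNIV f"
    and g_lsc: "lsc_on UNIV (\<lambda>z. ereal (g z))"
    and h_proper: "proper_on UNIV h" and h_lsc: "lsc_on UNIV h"
    and Omega_nonempty: "Omega g \<noteq> {}"
    and blocks: "block_partition N B"
    and f_separable: "\<And>z. f z = (\<Sum>i=1..N. fs i (block (B i) z))"
    and fs_proper: "\<And>i. i \<in> {1..N} \<Longrightarrow> proper_on (block_space (B i)) (fs i)"
    and fs_lsc: "\<And>i. i \<in> {1..N} \<Longrightarrow> lsc_on (block_space (B i)) (fs i)"
    and f_cont: "continuous_on (effdom f) f"
    and fs_bdd_below: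
      "\<And>i. i \<in> {1..N} \<Longrightarrow> \<exists>m::real. \<forall>v\<in>block_space (B i). ereal m \<le> fs i v"
    and h_diff: "loc_lipschitz_differentiable_on (Omega g) h"
    and g_convex: "convex_on UNIV g" and g_nonneg: "\<And>z. g z \<ge> 0"
    and zeta_nonneg: "\<And>z. z \<in> effdom f \<Longrightarrow> f z + h z \<ge> 0"
    and \<alpha>_bounds: "0 < \<alpha>min" "\<alpha>min \<le> \<alpha>max"
    and \<sigma>_pos: "\<sigma> > 0" and \<gamma>_bounds: "0 < \<gamma>" "\<gamma> < 1"
    and generated: "CMPGA N B fs f g h \<alpha>min \<alpha>max \<sigma> \<gamma> M x y"
    and level_compact: "compact (level_set f g h (x 0))"
    and gbar_pos: "gbar > 0" and gbar_bound: "\<And>z. z \<in> level_set f g h (x 0) \<Longrightarrow> g z \<le> gbar"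
    and accumulation: "strict_mono r" "(\<lambda>k. (x (r k), y (r k))) \<longlonglongrightarrow> (xs, ys)"
  shows "((xs, ys) \<in> S_set g (level_set f g h (x 0)) gbar \<alpha>min \<and>
          (INF t. eta g (x t) (y t)) > 0) \<and>
         (xs \<in> effdom (F_obj f g h) \<and> critical_point f g h xs \<and>
          real_of_ereal (F_obj f g h xs) *\<^sub>R ys
            \<in> (\<lambda>w. real_of_ereal (F_obj f g h xs) *\<^sub>R w) ` convex_subdiff g xs)"
proof -
  interpret cmpga_run f h g N B fs \<alpha>min \<alpha>max \<sigma> \<gamma> gbar M x y
    by unfold_locales (fact assms)+
  show ?thesis using convergence[OF accumulation] by blast
qed

end
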